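(* For every $A \in Form$: $\vdash A$ if and only if $A$ is valid over normal jstit models (i.e. $\mathcal{M},m,h\models A$ for every normal jstit model $\mathcal{M}$ and every $(m,h)\in MH(\mathcal{M})$).
   Context: Language. $Ag$ is a fixed finite set of agents; $PVar$, $PConst$, $Var$ are countably infinite, pairwise disjoint sets of proof variables, proof constants and propositional variables. Proof polynomials ($Pol$): $t ::= x \mid c \mid s+t \mid s\times t \mid\, !t$ with $x\in PVar$, $c\in PConst$. Formulas ($Form$): $A ::= p \mid A\wedge B\mid \neg A\mid [j]A\mid \Box A\mid t{:}A\mid KA\mid Prove(j,A)\mid Proven(A)$ with $p\in Var$, $j\in Ag$, $t\in Pol$. Other Boolean connectives and $\bot$ are the usual abbreviations; $\Diamond,\langle K\rangle,\langle j\rangle$ are the duals of $\Box,K,[j]$. Axiom schemes. (A0) a full set of axioms for classical propositional logic; (A1) S5 axioms for $\Box$ and for each $[j]$; (A2) $\Box A\to[j]A$; (A3) $(\Diamond[j_1]A_1\wedge\ldots\wedge\Diamond[j_n]A_n)\to\Diamond([j_1]A_1\wedge\ldots\wedge[j_n]A_n)$ for pairwise different $j_1,\ldots,j_n$; (A4) $s{:}(A\to B)\to(t{:}A\to(s\times t){:}B)$; (A5) $t{:}A\to(!t{:}(t{:}A)\wedge KA)$; (A6) $(s{:}A\vee t{:}A)\to(s+t){:}A$; (A7) S4 axioms for $K$; (A8) $KA\to\Box K\Box A$; (A9) $Prove(j,A)\to(\neg Proven(A)\wedge[j]Prove(j,A)\wedge KA)$; (A10) $\Box Prove(j,A)\to\Box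 Prove(i,A)$; (A11) $Proven(A)\to(KProven(A)\wedge KA)$; (A12) $\neg K(\bigvee_{l=1}^n\langle K\rangle\Diamond Prove(j_l,A_l))$, $n\geq 1$; (A13) $\neg Prove(j,A)\to\langle j\rangle\bigwedge_{i\in Ag}\neg Prove(i,A)$. Rules. (R1) from $A$, $A\to B$ infer $B$; (R2) from $A$ infer $KA$; (R3) if $A$ is an instance of (A0)--(A13) and $c\in PConst$, infer $c{:}A$; (R4) from $KA\to(\neg Proven(B_1)\vee\ldots\vee\neg Proven(B_n))$ infer $KA\to(\bigwedge_{j\in Ag}\neg Prove(j,B_1)\vee\ldots\vee\bigwedge_{j\in Ag}\neg Prove(j,B_n))$. $\vdash A$ means that $A$ is the last formula of a finite sequence of formulas each of which is an axiom or follows from earlier ones by a rule. Models. A jstit model is $\mathcal{M}=\langle Tree,\leq,Choice,Act,R,\mathcal{E},V\rangle$ where $Tree\neq\emptyset$ (moments); $\leq$ is a partial order on $Tree$ ($<$ its strict part); $Hist$ is the set of maximal $\leq$-chains (histories), $H_m=\{h\in Hist\mid m\in h\}$, $MH(\mathcal{M})=\{(m,h)\mid m\in Tree,h\in H_m\}$; $Choice$ assigns to each $m\in Tree$, $j\in Ag$ a partition $Choice^m_j$ of $H_m$, $Choice^m_j(h)$ being the cell containing $h$; $Act:MH(\mathcal{M})\to 2^{Pol}$; $R$ is a preorder on $Tree$; $\mathcal{E}:Tree\times Pol\to 2^{Form}$; $V:Var\to 2^{MH(\mathcal{M})}$; and for all $m,m',m_1,m_2 \in Tree$, $j\in Ag$,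 $s,t\in Pol$, $A,B\in Form$: 1. any two moments have a common $\leq$-lower bound; 2. if $m_1\leq m$ and $m_2\leq m$ then $m_1\leq m_2$ or $m_2\leq m_1$; 3. if $h,h'\in H_m$, $m<m'$ and $m'\in h\cap h'$, then $Choice^m_j(h)=Choice^m_j(h')$; 4. if $f(j)\in Choice^m_j$ for all $j\in Ag$, then $\bigcap_{j\in Ag}f(j)\neq\emptyset$; 5. $R(m,m')$ implies $\mathcal{E}(m,t)\subseteq\mathcal{E}(m',t)$; 6. (a) $A\to B\in\mathcal{E}(m,s)$ and $A\in\mathcal{E}(m,t)$ imply $B\in\mathcal{E}(m,s\times t)$; (b) $\mathcal{E}(m,s)\cup\mathcal{E}(m,t)\subseteq\mathcal{E}(m,s+t)$; (c) $A\in\mathcal{E}(m,t)$ implies $t{:}A\in\mathcal{E}(m,!t)$; 7. $m'<m$ implies $Act(m',h)\subseteq Act(m,h)$ for all $h\in H_m$; 8. $\bigcap_{h\in H_m}Act(m,h)\subseteq\bigcup_{m'<m,\,h\in H_m}Act(m',h)$; 9. if $h,h'\in H_m$ and some $m'>m$ lies in $h\cap h'$, then $Act(m,h)=Act(m,h')$; 10. $\leq\,\subseteq R$; 11. $R(m,m')$ implies $\bigcap_{h\in H_m}Act(m,h)\subseteq\bigcap_{h'\in H_{m'}}Act(m',h')$. The model is normal iff for every $c\in PConst$ and $m\in Tree$, every instance of (A0)--(A13) is in $\mathcal{E}(m,c)$. Satisfaction at $(m,h)\in MH(\mathcal{M})$ (Boolean clauses standard): $p$ iff $(m,h)\in V(p)$;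 $[j]A$ iff $\mathcal{M},m,h'\models A$ for all $h'\in Choice^m_j(h)$; $\Box A$ iff $\mathcal{M},m,h'\models A$ for all $h'\in H_m$; $KA$ iff $\mathcal{M},m',h'\models A$ for all $m'$ with $R(m,m')$ and all $h'\in H_{m'}$; $t{:}A$ iff $A\in\mathcal{E}(m,t)$ and $\mathcal{M},m,h\models KA$; $Prove(j,A)$ iff (for all $h'\in Choice^m_j(h)$ there is $t\in Act(m,h')$ with $\mathcal{M},m,h'\models t{:}A$) and (for every $s\in Pol$ there is $h''\in H_m$ such that $\mathcal{M},m,h\models s{:}A$ implies $s\notin Act(m,h'')$); $Proven(A)$ iff there is $t\in Pol$ such that for all $h'\in H_m$, $t\in Act(m,h')$ and $\mathcal{M},m,h\models t{:}A$. *)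

theory Defs
  imports Main "HOL-Library.Disjoint_Sets"
begin


text \<open>The countably infinite sets of proof variables, proof constants and propositional
  variables are indexed by \<^typ>\<open>nat\<close> and kept disjoint by the constructors.
  The finite set of agents is a type of class \<^class>\<open>finite\<close>.\<close>

datatype pol =
    PVar nat
  | PConst nat
  | Sum pol pol
  | App pol pol
  | Bang pol

datatype 'ag form =
    Atom nat
  | And "'ag form" "'ag form"  (infixr \<open>\<^bold>\<and>\<close> 65)
  | Neg "'ag form"  (\<open>\<^bold>\<not> _\<close> [70] 70)
  | Stit 'ag "'ag form"
  | Box "'ag form"
  | Just pol "'ag form"
  | Know "'ag form"
  | Prove 'ag "'ag form"
  | Proven "'ag form"

abbreviation Or :: "'ag form \<Rightarrow> 'ag form \<Rightarrow> 'ag form"  (infixr \<open>\<^bold>\<or>\<close> 60) where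
  "A \<^bold>\<or> B \<equiv> \<^bold>\<not> (\<^bold>\<not> A \<^bold>\<and> \<^bold>\<not> B)"

abbreviation Imp :: "'ag form \<Rightarrow> 'ag form \<Rightarrow> 'ag form"  (infixr \<open>\<^bold>\<rightarrow>\<close> 55) where
  "A \<^bold>\<rightarrow> B \<equiv> \<^bold>\<not> (A \<^bold>\<and> \<^bold>\<not> B)"

abbreviation Falsum :: "'ag form"  (\<open>\<^bold>\<bottom>\<close>) where
  "\<^bold>\<bottom> \<equiv> Atom 0 \<^bold>\<and> \<^bold>\<not> Atom 0"

abbreviation Dia :: "'ag form \<Rightarrow> 'ag form" where
  "Dia A \<equiv> \<^bold>\<not> Box (\<^bold>\<not> A)"

abbreviation DiaK :: "'ag form \<Rightarrow> 'ag form" where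
  "DiaK A \<equiv> \<^bold>\<not> Know (\<^bold>\<not> A)"

abbreviation DiaStit :: "'ag \<Rightarrow> 'ag form \<Rightarrow> 'ag form" where
  "DiaStit j A \<equiv> \<^bold>\<not> Stit j (\<^bold>\<not> A)"

fun Conj :: "'ag form list \<Rightarrow> 'ag form" where
  "Conj [] = \<^bold>\<not> \<^bold>\<bottom>"
| "Conj [A] = A"
| "Conj (A # B # As) = A \<^bold>\<and> Conj (B # As)"

fun Disj :: "'ag form list \<Rightarrow> 'ag form" where
  "Disj [] = \<^bold>\<bottom>"
| "Disj [A] = A"
| "Disj (A # B # As) = A \<^bold>\<or> Disj (B # As)"

text \<open>A fixed enumeration of the agents, giving a meaning to conjunctions indexed by all
  agents.\<close>

definition agents :: "'ag::finite list" where
  "agents = (SOME js. distinct js \<and> set js = UNIV)"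

lemma agents: "distinct (agents :: 'ag::finite list)" "set (agents :: 'ag list) = UNIV"
proof -
  have "\<exists>js :: 'ag list. distinct js \<and> set js = UNIV"
    using finite_distinct_list[of "UNIV :: 'ag set"] by auto
  from someI_ex[OF this]
  show "distinct (agents :: 'ag list)" "set (agents :: 'ag list) = UNIV"
    unfolding agents_def by auto
qed



primrec bval :: "('ag form \<Rightarrow> bool) \<Rightarrow> 'ag form \<Rightarrow> bool" where
  "bval v (Atom p) = v (Atom p)"
| "bval v (A \<^bold>\<and> B) = (bval v A \<and> bval v B)"
| "bval v (\<^bold>\<not> A) = (\<not> bval v A)"
| "bval v (Stit j A) = v (Stit j A)"
| "bval v (Box A) = v (Box A)"
| "bval v (Just t A) = v (Just t A)"
| "bval v (Know A) = v (Know A)"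
| "bval v (Prove j A) = v (Prove j A)"
| "bval v (Proven A) = v (Proven A)"

definition tautology :: "'ag form \<Rightarrow> bool" where
  "tautology A \<longleftrightarrow> (\<forall>v. bval v A)"

text \<open>As the full set of classical propositional axioms we take all instances of
  propositional tautologies.\<close>

inductive "axiom" :: "'ag::finite form \<Rightarrow> bool" where
  A0: "tautology A \<Longrightarrow> axiom A"
| A1_Box_K: "axiom (Box (A \<^bold>\<rightarrow> B) \<^bold>\<rightarrow> Box A \<^bold>\<rightarrow> Box B)"
| A1_Box_T: "axiom (Box A \<^bold>\<rightarrow> A)"
| A1_Box_4: "axiom (Box A \<^bold>\<rightarrow> Box (Box A))"
| A1_Box_5: "axiom (Dia A \<^bold>\<rightarrow> Box (Dia A))"
| A1_Stit_K: "axiom (Stit j (A \<^bold>\<rightarrow> B) \<^bold>\<rightarrow> Stit j A \<^bold>\<rightarrow> Stit j B)"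
| A1_Stit_T: "axiom (Stit j A \<^bold>\<rightarrow> A)"
| A1_Stit_4: "axiom (Stit j A \<^bold>\<rightarrow> Stit j (Stit j A))"
| A1_Stit_5: "axiom (DiaStit j A \<^bold>\<rightarrow> Stit j (DiaStit j A))"
| A2: "axiom (Box A \<^bold>\<rightarrow> Stit j A)"
| A3: "\<lbrakk>jAs \<noteq> []; distinct (map fst jAs)\<rbrakk> \<Longrightarrow>
    axiom (Conj (map (\<lambda>(j, A). Dia (Stit j A)) jAs) \<^bold>\<rightarrow>
           Dia (Conj (map (\<lambda>(j, A). Stit j A) jAs)))"
| A4: "axiom (Just s (A \<^bold>\<rightarrow> B) \<^bold>\<rightarrow> Just t A \<^bold>\<rightarrow> Just (App s t) B)"
| A5: "axiom (Just t A \<^bold>\<rightarrow> Just (Bang t) (Just t A) \<^bold>\<and> Know A)"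
| A6: "axiom (Just s A \<^bold>\<or> Just t A \<^bold>\<rightarrow> Just (Sum s t) A)"
| A7_K: "axiom (Know (A \<^bold>\<rightarrow> B) \<^bold>\<rightarrow> Know A \<^bold>\<rightarrow> Know B)"
| A7_T: "axiom (Know A \<^bold>\<rightarrow> A)"
| A7_4: "axiom (Know A \<^bold>\<rightarrow> Know (Know A))"
| A8: "axiom (Know A \<^bold>\<rightarrow> Box (Know (Box A)))"
| A9: "axiom (Prove j A \<^bold>\<rightarrow> \<^bold>\<not> Proven A \<^bold>\<and> Stit j (Prove j A) \<^bold>\<and> Know A)"
| A10: "axiom (Box (Prove j A) \<^bold>\<rightarrow> Box (Prove i A))"
| A11: "axiom (Proven A \<^bold>\<rightarrow> Know (Proven A) \<^bold>\<and> Know A)"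
| A12: "jAs \<noteq> [] \<Longrightarrow>
    axiom (\<^bold>\<not> Know (Disj (map (\<lambda>(j, A). DiaK (Dia (Prove j A))) jAs)))"
| A13: "axiom (\<^bold>\<not> Prove j A \<^bold>\<rightarrow> DiaStit j (Conj (map (\<lambda>i. \<^bold>\<not> Prove i A) agents)))"

inductive by_rule :: "'ag::finite form set \<Rightarrow> 'ag form \<Rightarrow> bool" for S where
  R1: "\<lbrakk>A \<in> S; (A \<^bold>\<rightarrow> B) \<in> S\<rbrakk> \<Longrightarrow> by_rule S B"
| R2: "A \<in> S \<Longrightarrow> by_rule S (Know A)"
| R3: "axiom A \<Longrightarrow> by_rule S (Just (PConst c) A)"
| R4: "\<lbrakk>Bs \<noteq> []; (Know A \<^bold>\<rightarrow> Disj (map (\<lambda>B. \<^bold>\<not> Proven B) Bs)) \<in> S\<rbrakk> \<Longrightarrow>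
    by_rule S (Know A \<^bold>\<rightarrow> Disj (map (\<lambda>B. Conj (map (\<lambda>j. \<^bold>\<not> Prove j B) agents)) Bs))"

definition is_derivation :: "'ag::finite form list \<Rightarrow> bool" where
  "is_derivation As \<longleftrightarrow>
     (\<forall>i < length As. axiom (As ! i) \<or> by_rule (set (take i As)) (As ! i))"

definition derivable :: "'ag::finite form \<Rightarrow> bool"  (\<open>\<turnstile> _\<close> [50] 50) where
  "\<turnstile> A \<longleftrightarrow> (\<exists>As. As \<noteq> [] \<and> is_derivation As \<and> last As = A)"



text \<open>The type \<open>'m\<close> is only an ambient universe for moments; the moments of a model form
  a subset of it.\<close>

record ('ag, 'm) jstit =
  Tree :: "'m set"
  Ord :: "('m \<times> 'm) set"
  Choice :: "'m \<Rightarrow> 'ag \<Rightarrow> 'm set set set"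
  Act :: "'m \<Rightarrow> 'm set \<Rightarrow> pol set"
  Rel :: "('m \<times> 'm) set"
  Evid :: "'m \<Rightarrow> pol \<Rightarrow> 'ag form set"
  Val :: "nat \<Rightarrow> ('m \<times> 'm set) set"

definition le :: "('ag, 'm, 'z) jstit_scheme \<Rightarrow> 'm \<Rightarrow> 'm \<Rightarrow> bool" where
  "le M m m' \<longleftrightarrow> (m, m') \<in> Ord M"

definition lt :: "('ag, 'm, 'z) jstit_scheme \<Rightarrow> 'm \<Rightarrow> 'm \<Rightarrow> bool" where
  "lt M m m' \<longleftrightarrow> (m, m') \<in> Ord M \<and> m \<noteq> m'"

definition Hist :: "('ag, 'm, 'z) jstit_scheme \<Rightarrow> 'm set set" where
  "Hist M = {h. pred_on.maxchain (Tree M) (lt M) h}"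

definition H :: "('ag, 'm, 'z) jstit_scheme \<Rightarrow> 'm \<Rightarrow> 'm set set" where
  "H M m = {h \<in> Hist M. m \<in> h}"

definition MH :: "('ag, 'm, 'z) jstit_scheme \<Rightarrow> ('m \<times> 'm set) set" where
  "MH M = {(m, h). m \<in> Tree M \<and> h \<in> H M m}"

definition cell :: "('ag, 'm, 'z) jstit_scheme \<Rightarrow> 'm \<Rightarrow> 'ag \<Rightarrow> 'm set \<Rightarrow> 'm set set" where
  "cell M m j h = (THE C. C \<in> Choice M m j \<and> h \<in> C)"

locale jstit_model =
  fixes M :: "('ag::finite, 'm) jstit"
  assumes Tree_nonempty: "Tree M \<noteq> {}"
    and Ord_partial_order: "partial_order_on (Tree M) (Ord M)"
    and Choice_partition: "m \<in> Tree M \<Longrightarrow> partition_on (H M m) (Choice M m j)"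
    and Rel_preorder: "preorder_on (Tree M) (Rel M)"
    and Val_subset: "Val M p \<subseteq> MH M"
    and historical_connection:
      "\<lbrakk>m1 \<in> Tree M; m2 \<in> Tree M\<rbrakk> \<Longrightarrow> \<exists>m \<in> Tree M. le M m m1 \<and> le M m m2"
    and no_backward_branching:
      "\<lbrakk>m \<in> Tree M; m1 \<in> Tree M; m2 \<in> Tree M; le M m1 m; le M m2 m\<rbrakk> \<Longrightarrow>
       le M m1 m2 \<or> le M m2 m1"
    and no_choice_between_undivided:
      "\<lbrakk>m \<in> Tree M; m' \<in> Tree M; h \<in> H M m; h' \<in> H M m; lt M m m'; m' \<in> h \<inter> h'\<rbrakk> \<Longrightarrow>
       cell M m j h = cell M m j h'"
    and independence:
      "\<lbrakk>m \<in> Tree M; \<And>j. f j \<in> Choice M m j\<rbrakk> \<Longrightarrow> (\<Inter>j. f j) \<noteq> {}"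
    and Evid_mono:
      "\<lbrakk>m \<in> Tree M; m' \<in> Tree M; (m, m') \<in> Rel M\<rbrakk> \<Longrightarrow> Evid M m t \<subseteq> Evid M m' t"
    and Evid_App:
      "\<lbrakk>m \<in> Tree M; (A \<^bold>\<rightarrow> B) \<in> Evid M m s; A \<in> Evid M m t\<rbrakk> \<Longrightarrow> B \<in> Evid M m (App s t)"
    and Evid_Sum:
      "m \<in> Tree M \<Longrightarrow> Evid M m s \<union> Evid M m t \<subseteq> Evid M m (Sum s t)"
    and Evid_Bang:
      "\<lbrakk>m \<in> Tree M; A \<in> Evid M m t\<rbrakk> \<Longrightarrow> Just t A \<in> Evid M m (Bang t)"
    and Act_expansion:
      "\<lbrakk>m \<in> Tree M; m' \<in> Tree M; lt M m' m; h \<in> H M m\<rbrakk> \<Longrightarrow> Act M m' h \<subseteq> Act M m h"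
    and no_new_proofs_guaranteed:
      "m \<in> Tree M \<Longrightarrow>
       (\<Inter>h \<in> H M m. Act M m h) \<subseteq> (\<Union>m' \<in> {m' \<in> Tree M. lt M m' m}. \<Union>h \<in> H M m. Act M m' h)"
    and presenting_new_proofs_makes_histories_divide:
      "\<lbrakk>m \<in> Tree M; m' \<in> Tree M; h \<in> H M m; h' \<in> H M m; lt M m m'; m' \<in> h \<inter> h'\<rbrakk> \<Longrightarrow>
       Act M m h = Act M m h'"
    and future_always_matters: "Ord M \<subseteq> Rel M"
    and epistemic_transparency:
      "\<lbrakk>m \<in> Tree M; m' \<in> Tree M; (m, m') \<in> Rel M\<rbrakk> \<Longrightarrow>
       (\<Inter>h \<in> H M m. Act M m h) \<subseteq> (\<Inter>h' \<in> H M m'. Act M m' h')"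

definition normal :: "('ag::finite, 'm) jstit \<Rightarrow> bool" where
  "normal M \<longleftrightarrow> (\<forall>c. \<forall>m \<in> Tree M. \<forall>A. axiom A \<longrightarrow> A \<in> Evid M m (PConst c))"



text \<open>The weight makes \<open>t : A\<close> and \<open>K A\<close> smaller than \<open>Prove(j, A)\<close> and \<open>Proven(A)\<close>, whose
  truth conditions refer to \<open>t : A\<close> for arbitrary \<open>t\<close>.\<close>

primrec weight :: "'ag form \<Rightarrow> nat" where
  "weight (Atom p) = 1"
| "weight (A \<^bold>\<and> B) = weight A + weight B + 1"
| "weight (\<^bold>\<not> A) = weight A + 1"
| "weight (Stit j A) = weight A + 1"
| "weight (Box A) = weight A + 1"
| "weight (Just t A) = weight A + 2"
| "weight (Know A) = weight A + 1"
| "weight (Prove j A) = weight A + 3"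
| "weight (Proven A) = weight A + 3"

function sat :: "('ag, 'm) jstit \<Rightarrow> 'm \<Rightarrow> 'm set \<Rightarrow> 'ag form \<Rightarrow> bool" where
  "sat M m h (Atom p) \<longleftrightarrow> (m, h) \<in> Val M p"
| "sat M m h (A \<^bold>\<and> B) \<longleftrightarrow> sat M m h A \<and> sat M m h B"
| "sat M m h (\<^bold>\<not> A) \<longleftrightarrow> \<not> sat M m h A"
| "sat M m h (Stit j A) \<longleftrightarrow> (\<forall>h' \<in> cell M m j h. sat M m h' A)"
| "sat M m h (Box A) \<longleftrightarrow> (\<forall>h' \<in> H M m. sat M m h' A)"
| "sat M m h (Know A) \<longleftrightarrow>
     (\<forall>m' \<in> Tree M. (m, m') \<in> Rel M \<longrightarrow> (\<forall>h' \<in> H M m'. sat M m' h' A))"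
| "sat M m h (Just t A) \<longleftrightarrow> A \<in> Evid M m t \<and> sat M m h (Know A)"
| "sat M m h (Prove j A) \<longleftrightarrow>
     (\<forall>h' \<in> cell M m j h. \<exists>t \<in> Act M m h'. sat M m h' (Just t A)) \<and>
     (\<forall>s. \<exists>h'' \<in> H M m. sat M m h (Just s A) \<longrightarrow> s \<notin> Act M m h'')"
| "sat M m h (Proven A) \<longleftrightarrow>
     (\<exists>t. \<forall>h' \<in> H M m. t \<in> Act M m h' \<and> sat M m h (Just t A))"
  by pat_completeness auto
termination by (relation "measure (\<lambda>(M, m, h, A). weight A)") auto

text \<open>Validity over all normal models whose moments are taken from the type \<open>'m\<close>.\<close>

definition valid_normal :: "'m itself \<Rightarrow> 'ag::finite form \<Rightarrow> bool" where
  "valid_normal _ A \<longleftrightarrow>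
     (\<forall>M :: ('ag, 'm) jstit. jstit_model M \<and> normal M \<longrightarrow> (\<forall>(m, h) \<in> MH M. sat M m h A))"

text \<open>HOL has no quantification over types, so validity over all models has to be
  rendered by schematic polymorphism. A free type of moments alone is not enough: over a
  small type the formulas valid in all models may outrun the derivable ones. The type
  below is a universe of cardinality beth-two, large enough for models whose moments are
  built from lists of sets of formulas (or equivalence classes of such lists).\<close>

type_synonym 'ag moments = "('ag form set list \<times> nat) set"

end

theory Submission
  imports Defs "HOL-Library.Countable" "HOL-Library.Sublist"
begin

text \<open>The formula \<^term>\<open>A\<close> is refuted, if not derivable, in a tree of finite lists of maximal
  consistent sets, ordered by prefix, in which a history through \<open>m\<close> realises the set
  chosen right after \<open>m\<close>. Rule R4 is what makes it consistent that the next moment knows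
  everything known now and has \<^term>\<open>Proven B\<close> for every \<^term>\<open>B\<close> which is being proved now.
  Since \<^term>\<open>Prove j B\<close> need not come with any formula \<^term>\<open>Just t B\<close> in the set, the proofs
  presented in the model are proof variables not occurring in \<^term>\<open>A\<close>, and the truth lemma is
  restricted to formulas without them.

  Soundness of A12 and R4 rests on the observation that a history on which something is being
  proved has a later moment, and that the proof is settled there.\<close>

section \<open>The Hilbert calculus\<close>

text \<open>The frame conditions on presented proofs shape the model. A proof presented on all
  histories of a moment must have been presented before, so whatever is settled at an initial set
  needs a moment below it. This is the empty list, which also joins everything into a single tree.
  Nothing may be settled at this root; and a formula may be in the course of being proved on all
  histories of a moment, yet by no common proof. Both demands are met by bits, one for the initial
  set and one for each choice, which the presented variables record. Evidence and settled proofs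
  grow along \<open>Rel\<close>, so a moment refuting \<open>Know A\<close> must inherit all proofs
  settled so far. It is taken to be a fresh one-element list with the same initial bit; its settled
  proofs include the variables of every formula proven in its set. Truth is not claimed at the root:
  there the choices are trivial, and evidence is what all maximal consistent sets agree on.\<close>

lemma by_rule_mono: "by_rule S A \<Longrightarrow> S \<subseteq> S' \<Longrightarrow> by_rule S' A"
  by (cases rule: by_rule.cases) (auto intro: by_rule.intros)

lemma is_derivation_append:
  assumes "is_derivation As" "is_derivation Bs"
  shows "is_derivation (As @ Bs)"
  unfolding is_derivation_def
proof (intro allI impI)
  fix i assume i: "i < length (As @ Bs)"
  show "axiom ((As @ Bs) ! i) \<or> by_rule (set (take i (As @ Bs))) ((As @ Bs) ! i)"
  proof (cases "i < length As")
    case True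
    then show ?thesis using assms(1) by (auto simp: is_derivation_def nth_append)
  next
    case False
    with i have "i - length As < length Bs" by auto
    with assms(2) have "axiom (Bs ! (i - length As)) \<or>
        by_rule (set (take (i - length As) Bs)) (Bs ! (i - length As))"
      by (simp add: is_derivation_def)
    with False show ?thesis by (auto simp: nth_append intro: by_rule_mono)
  qed
qed

lemma is_derivation_snoc:
  assumes "is_derivation As" "axiom A \<or> by_rule (set As) A"
  shows "is_derivation (As @ [A])"
  using assms by (auto simp: is_derivation_def nth_append less_Suc_eq)

text \<open>A derivation may be cut off after any of its lines. Occurring in a derivation is easier
  to preserve under concatenation than being its last formula.\<close>

lemma derivable_iff: "\<turnstile> A \<longleftrightarrow> (\<exists>As. is_derivation As \<and> A \<in> set As)"
proof
  assume "\<exists>As. is_derivation As \<and> A \<in> set As"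
  then obtain As i where As: "is_derivation As" "i < length As" "A = As ! i"
    by (auto simp: in_set_conv_nth)
  then have "is_derivation (take (Suc i) As)"
    by (auto simp: is_derivation_def less_Suc_eq_le min_def)
  moreover have "take (Suc i) As \<noteq> []" "last (take (Suc i) As) = A"
    using As by (auto simp: take_Suc_conv_app_nth)
  ultimately show "\<turnstile> A" unfolding derivable_def by blast
qed (auto simp: derivable_def)

lemma derivable_axiom: "axiom A \<Longrightarrow> \<turnstile> A"
  unfolding derivable_iff by (rule exI[of _ "[A]"]) (simp add: is_derivation_def)

text \<open>The derivations of finitely many premises are concatenated into one, to which the
  conclusion is appended.\<close>

lemma derivable_rule:
  assumes "finite S" "\<forall>B \<in> S. \<turnstile> B" "by_rule S A"
  shows "\<turnstile> A"
proof -
  from assms(1,2) have "\<exists>As. is_derivation As \<and> S \<subseteq> set As"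
  proof (induction S rule: finite_induct)
    case empty
    show ?case by (rule exI[of _ "[]"]) (simp add: is_derivation_def)
  next
    case (insert B S)
    then obtain As Bs where "is_derivation As" "S \<subseteq> set As" "is_derivation Bs" "B \<in> set Bs"
      by (auto simp: derivable_iff)
    then have "is_derivation (As @ Bs)" "insert B S \<subseteq> set (As @ Bs)"
      by (auto intro: is_derivation_append)
    then show ?case by blast
  qed
  then obtain As where "is_derivation As" "S \<subseteq> set As" by blast
  with assms(3) have "is_derivation (As @ [A])"
    by (blast intro: is_derivation_snoc by_rule_mono)
  then show ?thesis by (auto simp: derivable_iff)
qed

lemma derivable_mp: "\<turnstile> A \<Longrightarrow> \<turnstile> A \<^bold>\<rightarrow> B \<Longrightarrow> \<turnstile> B"
  by (rule derivable_rule[of "{A, A \<^bold>\<rightarrow> B}"]) (auto intro: R1)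

lemma derivable_Know: "\<turnstile> A \<Longrightarrow> \<turnstile> Know A"
  by (rule derivable_rule[of "{A}"]) (auto intro: R2)

lemma derivable_R4:
  assumes "Bs \<noteq> []" "\<turnstile> Know A \<^bold>\<rightarrow> Disj (map (\<lambda>B. \<^bold>\<not> Proven B) Bs)"
  shows "\<turnstile> Know A \<^bold>\<rightarrow> Disj (map (\<lambda>B. Conj (map (\<lambda>j. \<^bold>\<not> Prove j B) agents)) Bs)"
  by (rule derivable_rule[OF _ _ R4[OF assms(1) singletonI]]) (use assms(2) in auto)

lemma derivable_induct [consumes 1, case_names axiom rule]:
  assumes "\<turnstile> A"
    and ax: "\<And>A. axiom A \<Longrightarrow> P A"
    and rl: "\<And>S A. (\<And>B. B \<in> S \<Longrightarrow> P B) \<Longrightarrow> by_rule S A \<Longrightarrow> P A"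
  shows "P A"
proof -
  from assms(1) obtain As where As: "is_derivation As" "A \<in> set As"
    by (auto simp: derivable_iff)
  have "P (As ! i)" if "i < length As" for i
    using that
  proof (induction i rule: less_induct)
    case (less i)
    then have "axiom (As ! i) \<or> by_rule (set (take i As)) (As ! i)"
      using As(1) by (simp add: is_derivation_def)
    then show ?case
    proof
      assume "by_rule (set (take i As)) (As ! i)"
      moreover have "P B" if "B \<in> set (take i As)" for B
        using that less by (auto simp: in_set_conv_nth)
      ultimately show ?thesis using rl by blast
    qed (rule ax)
  qed
  with As(2) show ?thesis by (auto simp: in_set_conv_nth)
qed

section \<open>Propositional reasoning in the calculus\<close>

lemma bval_Conj [simp]: "bval v (Conj As) \<longleftrightarrow> (\<forall>A \<in> set As. bval v A)"
  by (induction As rule: Conj.induct) auto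

lemma bval_Disj [simp]: "bval v (Disj As) \<longleftrightarrow> (\<exists>A \<in> set As. bval v A)"
  by (induction As rule: Disj.induct) auto

text \<open>Replaces propositional derivations by a computation with valuations: each premise is
  moved into an implication until a tautology remains.\<close>

lemma derivable_taut:
  assumes "\<forall>B \<in> set Bs. \<turnstile> B" "\<And>v. \<forall>B \<in> set Bs. bval v B \<Longrightarrow> bval v C"
  shows "\<turnstile> C"
  using assms
proof (induction Bs arbitrary: C)
  case Nil
  then show ?case by (intro derivable_axiom A0) (simp add: tautology_def)
next
  case (Cons B Bs)
  have "\<turnstile> B \<^bold>\<rightarrow> C" by (rule Cons.IH) (use Cons.prems in auto)
  with Cons.prems(1) show ?case by (auto intro: derivable_mp)
qed

text \<open>With nested implications instead of a conjunctive antecedent, distributing a modal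
  operator over the premises is a plain list induction.\<close>

definition Imps :: "'ag form list \<Rightarrow> 'ag form \<Rightarrow> 'ag form" where
  "Imps As A = foldr Imp As A"

lemma Imps_simps [simp]: "Imps [] A = A" "Imps (B # As) A = (B \<^bold>\<rightarrow> Imps As A)"
  by (simp_all add: Imps_def)

lemma bval_Imps [simp]: "bval v (Imps As A) \<longleftrightarrow> ((\<forall>B \<in> set As. bval v B) \<longrightarrow> bval v A)"
  by (induction As) auto


section \<open>Maximal consistent sets\<close>

definition consistent :: "'ag::finite form set \<Rightarrow> bool" where
  "consistent \<Gamma> \<longleftrightarrow> (\<nexists>As. set As \<subseteq> \<Gamma> \<and> \<turnstile> Imps As \<^bold>\<bottom>)"

definition mcs :: "'ag::finite form set \<Rightarrow> bool" where
  "mcs \<Gamma> \<longleftrightarrow> consistent \<Gamma> \<and> (\<forall>A. A \<in> \<Gamma> \<or> \<^bold>\<not> A \<in> \<Gamma>)"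

lemma consistent_cases:
  assumes "consistent \<Gamma>"
  shows "consistent (insert A \<Gamma>) \<or> consistent (insert (\<^bold>\<not> A) \<Gamma>)"
proof (rule ccontr)
  assume "\<not> ?thesis"
  then obtain As Bs where As: "set As \<subseteq> insert A \<Gamma>" "\<turnstile> Imps As \<^bold>\<bottom>"
    and Bs: "set Bs \<subseteq> insert (\<^bold>\<not> A) \<Gamma>" "\<turnstile> Imps Bs \<^bold>\<bottom>"
    by (auto simp: consistent_def)
  \<comment> \<open>What remains of both refutations without \<open>A\<close> and its negation. A
    valuation making \<open>A\<close> true must fail in \<open>As\<close> at a member of \<Gamma>,
    one making it false must do so in \<open>Bs\<close>.\<close>
  let ?Cs = "filter (\<lambda>C. C \<in> \<Gamma>) (As @ Bs)"
  have "\<turnstile> Imps ?Cs \<^bold>\<bottom>"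
  proof (rule derivable_taut[of "[Imps As \<^bold>\<bottom>, Imps Bs \<^bold>\<bottom>]"])
    fix v assume "\<forall>B \<in> set [Imps As \<^bold>\<bottom>, Imps Bs \<^bold>\<bottom>]. bval v B"
    then obtain C D where CD: "C \<in> set As" "\<not> bval v C" "D \<in> set Bs" "\<not> bval v D" by auto
    then have "C \<in> \<Gamma> \<or> D \<in> \<Gamma>" using As Bs by (cases "bval v A") auto
    with CD show "bval v (Imps ?Cs \<^bold>\<bottom>)" by auto
  qed (use As Bs in auto)
  moreover have "set ?Cs \<subseteq> \<Gamma>" by auto
  ultimately show False using assms unfolding consistent_def by blast
qed

lemma lindenbaum:
  assumes "consistent \<Sigma>"
  shows "\<exists>\<Gamma>. mcs \<Gamma> \<and> \<Sigma> \<subseteq> \<Gamma>"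
proof -
  let ?F = "{\<Gamma>. consistent \<Gamma> \<and> \<Sigma> \<subseteq> \<Gamma>}"
  have "\<exists>\<Gamma> \<in> ?F. \<forall>\<Delta> \<in> ?F. \<Gamma> \<subseteq> \<Delta> \<longrightarrow> \<Delta> = \<Gamma>"
  proof (rule subset_Zorn_nonempty)
    show "?F \<noteq> {}" using assms by auto
    fix \<C> assume C: "\<C> \<noteq> {}" "subset.chain ?F \<C>"
    have "consistent (\<Union>\<C>)"
      unfolding consistent_def
    proof
      assume "\<exists>As. set As \<subseteq> \<Union>\<C> \<and> \<turnstile> Imps As \<^bold>\<bottom>"
      then obtain As where As: "set As \<subseteq> \<Union>\<C>" "\<turnstile> Imps As \<^bold>\<bottom>" by blast
      obtain \<Gamma> where "\<Gamma> \<in> \<C>" "set As \<subseteq> \<Gamma>"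
        using finite_subset_Union_chain[OF finite_set As(1) C] by blast
      with As(2) C(2) show False
        by (auto simp: consistent_def subset.chain_def)
    qed
    moreover have "\<Sigma> \<subseteq> \<Union>\<C>" using C unfolding subset.chain_def by fast
    ultimately show "\<Union>\<C> \<in> ?F" by blast
  qed
  then obtain \<Gamma> where "\<Gamma> \<in> ?F" and F: "\<forall>\<Delta> \<in> ?F. \<Gamma> \<subseteq> \<Delta> \<longrightarrow> \<Delta> = \<Gamma>" by (rule bexE)
  then have \<Gamma>: "consistent \<Gamma>" "\<Sigma> \<subseteq> \<Gamma>" by simp_all
  have max: "\<Delta> = \<Gamma>" if "consistent \<Delta>" "\<Gamma> \<subseteq> \<Delta>" for \<Delta>
    using F that \<Gamma>(2) by simp
  have "A \<in> \<Gamma> \<or> \<^bold>\<not> A \<in> \<Gamma>" for A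
    using consistent_cases[OF \<Gamma>(1), of A]
  proof
    assume "consistent (insert A \<Gamma>)"
    then have "insert A \<Gamma> = \<Gamma>" by (rule max) (rule subset_insertI)
    then show ?thesis by blast
  next
    assume "consistent (insert (\<^bold>\<not> A) \<Gamma>)"
    then have "insert (\<^bold>\<not> A) \<Gamma> = \<Gamma>" by (rule max) (rule subset_insertI)
    then show ?thesis by blast
  qed
  with \<Gamma> show ?thesis by (auto simp: mcs_def)
qed

lemma mcs_closed:
  assumes "mcs \<Gamma>" "set As \<subseteq> \<Gamma>" "\<turnstile> Imps As A"
  shows "A \<in> \<Gamma>"
proof (rule ccontr)
  assume "A \<notin> \<Gamma>"
  with assms have "set (\<^bold>\<not> A # As) \<subseteq> \<Gamma>" by (auto simp: mcs_def)
  moreover have "\<turnstile> Imps (\<^bold>\<not> A # As) \<^bold>\<bottom>"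
    by (rule derivable_taut[of "[Imps As A]"]) (use assms in auto)
  ultimately show False using assms(1) unfolding mcs_def consistent_def by blast
qed

lemma mcs_taut:
  assumes "mcs \<Gamma>" "set As \<subseteq> \<Gamma>" "\<And>v. \<forall>B \<in> set As. bval v B \<Longrightarrow> bval v A"
  shows "A \<in> \<Gamma>"
  using assms(1,2) by (rule mcs_closed) (rule derivable_taut[of "[]"], use assms(3) in auto)

lemma mcs_derivable: "mcs \<Gamma> \<Longrightarrow> \<turnstile> A \<Longrightarrow> A \<in> \<Gamma>"
  using mcs_closed[of \<Gamma> "[]" A] by simp

lemma mcs_axiom: "mcs \<Gamma> \<Longrightarrow> axiom A \<Longrightarrow> A \<in> \<Gamma>"
  by (blast intro: mcs_derivable derivable_axiom)

lemma mcs_And [simp]: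
  assumes "mcs \<Gamma>"
  shows "(A \<^bold>\<and> B) \<in> \<Gamma> \<longleftrightarrow> A \<in> \<Gamma> \<and> B \<in> \<Gamma>"
proof
  assume "(A \<^bold>\<and> B) \<in> \<Gamma>"
  then have "set [A \<^bold>\<and> B] \<subseteq> \<Gamma>" by simp
  from mcs_taut[OF assms this, of A] mcs_taut[OF assms this, of B]
  show "A \<in> \<Gamma> \<and> B \<in> \<Gamma>" by simp
next
  assume "A \<in> \<Gamma> \<and> B \<in> \<Gamma>"
  then have "set [A, B] \<subseteq> \<Gamma>" by simp
  from mcs_taut[OF assms this, of "A \<^bold>\<and> B"] show "(A \<^bold>\<and> B) \<in> \<Gamma>" by simp
qed

lemma mcs_Neg [simp]:
  assumes "mcs \<Gamma>"
  shows "\<^bold>\<not> A \<in> \<Gamma> \<longleftrightarrow> A \<notin> \<Gamma>"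
proof
  show "A \<notin> \<Gamma>" if "\<^bold>\<not> A \<in> \<Gamma>"
  proof
    assume "A \<in> \<Gamma>"
    with that have "set [A, \<^bold>\<not> A] \<subseteq> \<Gamma>" by simp
    moreover have "\<turnstile> Imps [A, \<^bold>\<not> A] \<^bold>\<bottom>" by (rule derivable_taut[of "[]"]) auto
    ultimately show False using assms unfolding mcs_def consistent_def by blast
  qed
qed (use assms in \<open>auto simp: mcs_def\<close>)

lemma mcs_Conj [simp]:
  assumes "mcs \<Gamma>"
  shows "Conj As \<in> \<Gamma> \<longleftrightarrow> (\<forall>A \<in> set As. A \<in> \<Gamma>)"
  by (induction As rule: Conj.induct) (use assms in auto)

lemma mcs_Disj [simp]:
  assumes "mcs \<Gamma>"
  shows "Disj As \<in> \<Gamma> \<longleftrightarrow> (\<exists>A \<in> set As. A \<in> \<Gamma>)"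
  by (induction As rule: Disj.induct) (use assms in auto)

section \<open>Normal modal operators\<close>

definition normal_op :: "('ag::finite form \<Rightarrow> 'ag form) \<Rightarrow> bool" where
  "normal_op N \<longleftrightarrow> (\<forall>A. (\<turnstile> A) \<longrightarrow> (\<turnstile> N A)) \<and> (\<forall>A B. \<turnstile> N (A \<^bold>\<rightarrow> B) \<^bold>\<rightarrow> N A \<^bold>\<rightarrow> N B)"

lemma normal_op_Imps:
  assumes "normal_op N" "\<turnstile> Imps As A"
  shows "\<turnstile> Imps (map N As) (N A)"
proof -
  have "\<turnstile> N (Imps As A) \<^bold>\<rightarrow> Imps (map N As) (N A)"
  proof (induction As)
    case Nil
    show ?case by (rule derivable_taut[of "[]"]) auto
  next
    case (Cons B As)
    have "\<turnstile> N (B \<^bold>\<rightarrow> Imps As A) \<^bold>\<rightarrow> N B \<^bold>\<rightarrow> N (Imps As A)"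
      using assms(1) by (simp add: normal_op_def)
    with Cons show ?case
      by (intro derivable_taut[of "[N (B \<^bold>\<rightarrow> Imps As A) \<^bold>\<rightarrow> N B \<^bold>\<rightarrow> N (Imps As A),
        N (Imps As A) \<^bold>\<rightarrow> Imps (map N As) (N A)]"]) auto
  qed
  moreover have "\<turnstile> N (Imps As A)" using assms by (simp add: normal_op_def)
  ultimately show ?thesis by (rule derivable_mp[rotated])
qed

lemma normal_op_mcs:
  assumes "normal_op N" "mcs \<Gamma>" "\<turnstile> Imps As A" "\<forall>B \<in> set As. N B \<in> \<Gamma>"
  shows "N A \<in> \<Gamma>"
  using mcs_closed[OF assms(2) _ normal_op_Imps[OF assms(1,3)]] assms(4) by auto

lemma normal_op_mono:
  assumes "normal_op N" "mcs \<Gamma>" "N A \<in> \<Gamma>" "\<turnstile> A \<^bold>\<rightarrow> B"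
  shows "N B \<in> \<Gamma>"
  using normal_op_mcs[of N \<Gamma> "[A]" B] assms by simp

lemma normal_op_nec: "normal_op N \<Longrightarrow> \<turnstile> A \<Longrightarrow> \<turnstile> N A"
  by (simp add: normal_op_def)

lemma normal_op_Conj:
  assumes "normal_op N" "mcs \<Gamma>"
  shows "N (Conj As) \<in> \<Gamma> \<longleftrightarrow> (\<forall>A \<in> set As. N A \<in> \<Gamma>)"
proof
  show "N (Conj As) \<in> \<Gamma>" if "\<forall>A \<in> set As. N A \<in> \<Gamma>"
    by (rule normal_op_mcs[OF assms _ that], rule derivable_taut[of "[]"]) auto
  show "\<forall>A \<in> set As. N A \<in> \<Gamma>" if N: "N (Conj As) \<in> \<Gamma>"
  proof
    fix A assume "A \<in> set As"
    then have "\<turnstile> Conj As \<^bold>\<rightarrow> A" by (intro derivable_taut[of "[]"]) auto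
    then show "N A \<in> \<Gamma>" by (rule normal_op_mono[OF assms N])
  qed
qed

text \<open>If the formulas \<open>B\<close> with \<open>N B\<close> in \<Gamma> refuted the
  negation of \<open>A\<close>, finitely many of them would imply \<open>A\<close>, and normality
  would put \<open>N A\<close> into \<Gamma>.\<close>

lemma mcs_existence:
  assumes "normal_op N" "mcs \<Gamma>" "N A \<notin> \<Gamma>"
  shows "\<exists>\<Delta>. mcs \<Delta> \<and> (\<forall>B. N B \<in> \<Gamma> \<longrightarrow> B \<in> \<Delta>) \<and> A \<notin> \<Delta>"
proof -
  have "consistent (insert (\<^bold>\<not> A) {B. N B \<in> \<Gamma>})"
    unfolding consistent_def
  proof
    assume "\<exists>As. set As \<subseteq> insert (\<^bold>\<not> A) {B. N B \<in> \<Gamma>} \<and> \<turnstile> Imps As \<^bold>\<bottom>"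
    then obtain As where As: "set As \<subseteq> insert (\<^bold>\<not> A) {B. N B \<in> \<Gamma>}" "\<turnstile> Imps As \<^bold>\<bottom>" by blast
    let ?Bs = "filter (\<lambda>B. N B \<in> \<Gamma>) As"
    have "\<turnstile> Imps ?Bs A"
      by (rule derivable_taut[of "[Imps As \<^bold>\<bottom>]"]) (use As in auto)
    then have "N A \<in> \<Gamma>" by (rule normal_op_mcs[OF assms(1,2)]) auto
    with assms(3) show False by blast
  qed
  then obtain \<Delta> where \<Delta>: "mcs \<Delta>" "insert (\<^bold>\<not> A) {B. N B \<in> \<Gamma>} \<subseteq> \<Delta>" using lindenbaum by blast
  then have "\<^bold>\<not> A \<in> \<Delta>" by simp
  with \<Delta>(1) have "A \<notin> \<Delta>" by simp
  with \<Delta> show ?thesis by blast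
qed

lemma normal_op_Know: "normal_op Know"
  by (simp add: normal_op_def derivable_Know derivable_axiom A7_K)

text \<open>Necessitation is a rule for \<open>Know\<close> only. For \<open>Box\<close> it comes
  out of A8 once the outer \<open>Box\<close> and \<open>Know\<close> are stripped by reflexivity;
  A2 then hands it on to \<open>Stit\<close>.\<close>

lemma normal_op_Box: "normal_op Box"
  unfolding normal_op_def
proof (intro conjI allI impI)
  fix A :: "'a form" assume "\<turnstile> A"
  from derivable_mp[OF derivable_Know[OF this] derivable_axiom[OF A8]]
  have "\<turnstile> Know (Box A)" by (rule derivable_mp[OF _ derivable_axiom[OF A1_Box_T]])
  then show "\<turnstile> Box A" by (rule derivable_mp[OF _ derivable_axiom[OF A7_T]])
qed (rule derivable_axiom[OF A1_Box_K])

lemma normal_op_Stit: "normal_op (Stit j)"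
  unfolding normal_op_def
proof (intro conjI allI impI)
  fix A :: "'a form" assume "\<turnstile> A"
  then have "\<turnstile> Box A" by (rule normal_op_nec[OF normal_op_Box])
  then show "\<turnstile> Stit j A" by (rule derivable_mp[OF _ derivable_axiom[OF A2]])
qed (rule derivable_axiom[OF A1_Stit_K])

section \<open>Equivalence of maximal consistent sets under S5 operators\<close>

definition sim :: "('ag form \<Rightarrow> 'ag form) \<Rightarrow> 'ag form set \<Rightarrow> 'ag form set \<Rightarrow> bool" where
  "sim N \<Gamma> \<Delta> \<longleftrightarrow> (\<forall>A. N A \<in> \<Gamma> \<longleftrightarrow> N A \<in> \<Delta>)"

definition S5_op :: "('ag::finite form \<Rightarrow> 'ag form) \<Rightarrow> bool" where
  "S5_op N \<longleftrightarrow> normal_op N \<and> (\<forall>A. \<turnstile> N A \<^bold>\<rightarrow> A) \<and> (\<forall>A. \<turnstile> N A \<^bold>\<rightarrow> N (N A)) \<and>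
     (\<forall>A. \<turnstile> \<^bold>\<not> N (\<^bold>\<not> A) \<^bold>\<rightarrow> N (\<^bold>\<not> N (\<^bold>\<not> A)))"

lemma S5_op_Box: "S5_op Box" and S5_op_Stit: "S5_op (Stit j)"
  by (simp_all add: S5_op_def normal_op_Box normal_op_Stit derivable_axiom A1_Box_T A1_Box_4
      A1_Box_5 A1_Stit_T A1_Stit_4 A1_Stit_5)

lemma sim_sym: "sim N \<Gamma> \<Delta> \<longleftrightarrow> sim N \<Delta> \<Gamma>"
  by (auto simp: sim_def)

lemma S5_T: "S5_op N \<Longrightarrow> mcs \<Gamma> \<Longrightarrow> N A \<in> \<Gamma> \<Longrightarrow> A \<in> \<Gamma>"
  using mcs_derivable[of \<Gamma> "N A \<^bold>\<rightarrow> A"] by (auto simp: S5_op_def)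

lemma S5_4: "S5_op N \<Longrightarrow> mcs \<Gamma> \<Longrightarrow> N A \<in> \<Gamma> \<Longrightarrow> N (N A) \<in> \<Gamma>"
  using mcs_derivable[of \<Gamma> "N A \<^bold>\<rightarrow> N (N A)"] by (auto simp: S5_op_def)

lemma sim_sub: "S5_op N \<Longrightarrow> sim N \<Gamma> \<Delta> \<Longrightarrow> mcs \<Delta> \<Longrightarrow> N A \<in> \<Gamma> \<Longrightarrow> A \<in> \<Delta>"
  by (auto simp: sim_def intro: S5_T)

text \<open>One direction suffices in S5: if \<open>N A\<close> were missing from \<Gamma>, negative
  introspection would carry this absence over to \<Delta>. The double negations arise because the
  dual of \<open>N\<close> is written with \<open>N\<close> and negation.\<close>

lemma simI:
  assumes "S5_op N" "mcs \<Gamma>" "mcs \<Delta>" "\<And>A. N A \<in> \<Gamma> \<Longrightarrow> A \<in> \<Delta>"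
  shows "sim N \<Gamma> \<Delta>"
  unfolding sim_def
proof (intro allI iffI)
  fix A
  show "N A \<in> \<Delta>" if "N A \<in> \<Gamma>" using assms that by (blast intro: S5_4)
  show "N A \<in> \<Gamma>" if "N A \<in> \<Delta>"
  proof (rule ccontr)
    assume "N A \<notin> \<Gamma>"
    have N: "normal_op N" using assms(1) by (simp add: S5_op_def)
    have "\<turnstile> \<^bold>\<not> \<^bold>\<not> A \<^bold>\<rightarrow> A" by (rule derivable_taut[of "[]"]) auto
    with \<open>N A \<notin> \<Gamma>\<close> have "N (\<^bold>\<not> \<^bold>\<not> A) \<notin> \<Gamma>" using normal_op_mono[OF N assms(2)] by blast
    then have "N (\<^bold>\<not> N (\<^bold>\<not> \<^bold>\<not> A)) \<in> \<Gamma>"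
      using assms(1,2) mcs_derivable[of \<Gamma> "\<^bold>\<not> N (\<^bold>\<not> \<^bold>\<not> A) \<^bold>\<rightarrow> N (\<^bold>\<not> N (\<^bold>\<not> \<^bold>\<not> A))"]
      by (auto simp: S5_op_def)
    then have "\<^bold>\<not> N (\<^bold>\<not> \<^bold>\<not> A) \<in> \<Delta>" by (rule assms(4))
    then have "N (\<^bold>\<not> \<^bold>\<not> A) \<notin> \<Delta>" using assms(3) by simp
    moreover have "\<turnstile> A \<^bold>\<rightarrow> \<^bold>\<not> \<^bold>\<not> A" by (rule derivable_taut[of "[]"]) auto
    then have "N (\<^bold>\<not> \<^bold>\<not> A) \<in> \<Delta>" by (rule normal_op_mono[OF N assms(3) that])
    ultimately show False by contradiction
  qed
qed

lemma sim_existence: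
  assumes "S5_op N" "mcs \<Gamma>" "N A \<notin> \<Gamma>"
  shows "\<exists>\<Delta>. mcs \<Delta> \<and> sim N \<Gamma> \<Delta> \<and> A \<notin> \<Delta>"
proof -
  obtain \<Delta> where "mcs \<Delta>" "\<forall>B. N B \<in> \<Gamma> \<longrightarrow> B \<in> \<Delta>" "A \<notin> \<Delta>"
    using mcs_existence[of N \<Gamma> A] assms by (auto simp: S5_op_def)
  then have "sim N \<Gamma> \<Delta>" by (intro simI[OF assms(1,2)]) auto
  with \<open>mcs \<Delta>\<close> \<open>A \<notin> \<Delta>\<close> show ?thesis by blast
qed

section \<open>Soundness\<close>

lemma maxchain_ex:
  assumes "x \<in> T"
  shows "\<exists>h. pred_on.maxchain T P h \<and> x \<in> h"
proof -
  \<comment> \<open>Among the elements comparable with \<open>x\<close>, a maximal chain must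
    contain \<open>x\<close>, since \<open>x\<close> could be added. Conversely, a chain through
    \<open>x\<close> never leaves this set, so maximality here is maximality in
    \<open>T\<close>.\<close>
  let ?T = "{y \<in> T. y = x \<or> P x y \<or> P y x}"
  obtain h where h: "pred_on.maxchain ?T P h" using pred_on.Hausdorff[of ?T P] by blast
  then have ch: "pred_on.chain ?T P h" and max: "\<And>h'. pred_on.chain ?T P h' \<Longrightarrow> \<not> h \<subset> h'"
    by (auto simp: pred_on.maxchain_def)
  have "pred_on.chain ?T P (insert x h)"
    using ch assms by (auto simp: pred_on.chain_def)
  with max[of "insert x h"] have x: "x \<in> h" by auto
  have "pred_on.maxchain T P h"
    unfolding pred_on.maxchain_def
  proof (intro conjI notI)
    show "pred_on.chain T P h" using ch by (auto simp: pred_on.chain_def)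
    assume "\<exists>S. pred_on.chain T P S \<and> h \<subset> S"
    then obtain S where S: "pred_on.chain T P S" "h \<subset> S" by blast
    with x have "x \<in> S" by blast
    with S have "pred_on.chain ?T P S" by (auto simp: pred_on.chain_def)
    with max S(2) show False by blast
  qed
  with x show ?thesis by blast
qed

text \<open>Histories depend on the moments and their order alone. Separating this part makes the
  facts available both in arbitrary models and for the bare canonical tree, where they are needed
  before choices and presented proofs are defined.\<close>

locale jstit_frame =
  fixes M :: "('ag, 'm) jstit"
  assumes po: "partial_order_on (Tree M) (Ord M)"
    and nbb: "\<lbrakk>m \<in> Tree M; m1 \<in> Tree M; m2 \<in> Tree M; le M m1 m; le M m2 m\<rbrakk> \<Longrightarrow>
       le M m1 m2 \<or> le M m2 m1"
begin

lemma le_refl: "m \<in> Tree M \<Longrightarrow> le M m m"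
  using po by (auto simp: partial_order_on_def preorder_on_def refl_on_def le_def)

lemma le_trans: "le M m m' \<Longrightarrow> le M m' m'' \<Longrightarrow> le M m m''"
  using po by (auto simp: partial_order_on_def preorder_on_def le_def dest: transD)

lemma lt_iff: "lt M m m' \<longleftrightarrow> le M m m' \<and> m \<noteq> m'"
  by (simp add: lt_def le_def)

lemma Hist_subset: "h \<in> Hist M \<Longrightarrow> h \<subseteq> Tree M"
  by (auto simp: Hist_def pred_on.maxchain_def pred_on.chain_def)

lemma Hist_total:
  assumes "h \<in> Hist M" "m \<in> h" "m' \<in> h"
  shows "le M m m' \<or> le M m' m"
proof -
  have "(lt M)\<^sup>=\<^sup>= m m' \<or> (lt M)\<^sup>=\<^sup>= m' m"
    using assms by (simp add: Hist_def pred_on.maxchain_def pred_on.chain_def)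
  then show ?thesis using le_refl assms Hist_subset by (auto simp: lt_iff)
qed

lemma Hist_maximal:
  assumes "h \<in> Hist M" "m \<in> Tree M" "\<forall>m' \<in> h. le M m m' \<or> le M m' m"
  shows "m \<in> h"
proof (rule ccontr)
  assume "m \<notin> h"
  have "pred_on.chain (Tree M) (lt M) (insert m h)"
    using assms by (auto simp: Hist_def pred_on.maxchain_def pred_on.chain_def lt_iff)
  with assms(1) \<open>m \<notin> h\<close> show False by (auto simp: Hist_def pred_on.maxchain_def)
qed

lemma Hist_downward:
  assumes "h \<in> Hist M" "m \<in> h" "m' \<in> Tree M" "le M m' m"
  shows "m' \<in> h"
proof (rule Hist_maximal[OF assms(1,3)], rule ballI)
  fix x assume "x \<in> h"
  then have x: "x \<in> Tree M" "m \<in> Tree M" using assms Hist_subset by auto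
  from Hist_total[OF assms(1) \<open>x \<in> h\<close> assms(2)] show "le M m' x \<or> le M x m'"
  proof
    assume "le M x m"
    with nbb[OF x(2) assms(3) x(1) assms(4)] show ?thesis by blast
  qed (use le_trans[OF assms(4)] in blast)
qed

lemma Hist_subset_eq:
  assumes "h \<in> Hist M" "g \<in> Hist M" "h \<subseteq> g"
  shows "h = g"
  using assms by (auto simp: Hist_def pred_on.maxchain_def)

lemma H_nonempty: "m \<in> Tree M \<Longrightarrow> \<exists>h. h \<in> H M m"
  using maxchain_ex[of m "Tree M" "lt M"] by (auto simp: H_def Hist_def)

lemma H_downward: "h \<in> H M m \<Longrightarrow> m' \<in> Tree M \<Longrightarrow> le M m' m \<Longrightarrow> h \<in> H M m'"
  using Hist_downward by (auto simp: H_def)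

text \<open>A history that ends in \<open>m\<close> consists of moments below \<open>m\<close>, and
  these lie on every history through \<open>m\<close>.\<close>

lemma H_singleton:
  assumes "h \<in> H M m" "\<nexists>m'. m' \<in> h \<and> lt M m m'"
  shows "H M m = {h}"
proof -
  have "g = h" if g: "g \<in> H M m" for g
  proof (rule Hist_subset_eq[symmetric])
    show "h \<subseteq> g"
    proof
      fix x assume "x \<in> h"
      then have "le M x m" "x \<in> Tree M"
        using assms Hist_total[of h m x] Hist_subset by (auto simp: H_def lt_iff)
      then show "x \<in> g" using g Hist_downward by (auto simp: H_def)
    qed
  qed (use assms g in \<open>auto simp: H_def\<close>)
  then show ?thesis using assms by blast
qed

end

section \<open>Validity of the axioms and rules\<close>

lemma sat_Conj [simp]: "sat M m h (Conj As) \<longleftrightarrow> (\<forall>A \<in> set As. sat M m h A)"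
  by (induction As rule: Conj.induct) auto

lemma sat_Disj [simp]: "sat M m h (Disj As) \<longleftrightarrow> (\<exists>A \<in> set As. sat M m h A)"
  by (induction As rule: Disj.induct) auto

text \<open>Satisfaction at a fixed moment and history is itself a Boolean valuation, which
  validates A0.\<close>

lemma bval_sat: "bval (sat M m h) A \<longleftrightarrow> sat M m h A"
  by (induction A) auto

sublocale jstit_model \<subseteq> jstit_frame
  by unfold_locales (fact Ord_partial_order, fact no_backward_branching)

context jstit_model
begin

lemma cell:
  assumes "m \<in> Tree M" "h \<in> H M m"
  shows cell_Choice: "cell M m j h \<in> Choice M m j" and cell_self: "h \<in> cell M m j h"
proof -
  have "\<exists>!C. C \<in> Choice M m j \<and> h \<in> C"
    using Choice_partition[OF assms(1), of j] assms(2)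
    by (auto simp: partition_on_def disjoint_def)
  from theI'[OF this] show "cell M m j h \<in> Choice M m j" "h \<in> cell M m j h"
    by (simp_all add: cell_def)
qed

lemma cell_unique:
  assumes "m \<in> Tree M" "h \<in> C" "C \<in> Choice M m j"
  shows "cell M m j h = C"
  unfolding cell_def
  by (rule the_equality)
    (use assms Choice_partition[OF assms(1), of j] in \<open>auto simp: partition_on_def disjoint_def\<close>)

lemma cell_eq:
  assumes "m \<in> Tree M" "h \<in> H M m" "h' \<in> cell M m j h"
  shows "cell M m j h' = cell M m j h"
  by (rule cell_unique[OF assms(1,3) cell_Choice[OF assms(1,2)]])

lemma cell_subset:
  assumes "m \<in> Tree M" "h \<in> H M m"
  shows "cell M m j h \<subseteq> H M m"
  using cell_Choice[OF assms, of j] Choice_partition[OF assms(1), of j]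
  by (auto simp: partition_on_def)

lemma Rel_refl: "m \<in> Tree M \<Longrightarrow> (m, m) \<in> Rel M"
  using Rel_preorder by (auto simp: preorder_on_def refl_on_def)

lemma Rel_trans: "(m, m') \<in> Rel M \<Longrightarrow> (m', m'') \<in> Rel M \<Longrightarrow> (m, m'') \<in> Rel M"
  using Rel_preorder by (auto simp: preorder_on_def dest: transD)

lemma sat_Know_mono:
  "(m, m') \<in> Rel M \<Longrightarrow> sat M m h (Know A) \<Longrightarrow> sat M m' h' (Know A)"
  using Rel_trans by (auto simp del: split_paired_All)

lemma sat_Just_mono:
  "m \<in> Tree M \<Longrightarrow> m' \<in> Tree M \<Longrightarrow> (m, m') \<in> Rel M \<Longrightarrow> sat M m h (Just t A) \<Longrightarrow> sat M m' h' (Just t A)"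
  using Evid_mono sat_Know_mono[of m m' h A h'] by auto

lemma sat_Proven_mono:
  assumes "m \<in> Tree M" "m' \<in> Tree M" "(m, m') \<in> Rel M" "sat M m h (Proven A)"
  shows "sat M m' h' (Proven A)"
proof -
  obtain h0 where "h0 \<in> H M m" using H_nonempty[OF assms(1)] by blast
  with assms(4) obtain t where t: "t \<in> (\<Inter>h \<in> H M m. Act M m h)" "sat M m h (Just t A)"
    by (auto simp del: sat.simps(6,7) simp: sat.simps(9))
  then have "t \<in> (\<Inter>h \<in> H M m'. Act M m' h)"
    using epistemic_transparency assms(1-3) by blast
  moreover have "sat M m' h' (Just t A)" using sat_Just_mono[OF assms(1-3) t(2)] .
  ultimately show ?thesis by (auto simp del: sat.simps(6,7) simp: sat.simps(9))
qed

lemma sat_Prove_not_Proven: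
  assumes "m \<in> Tree M" "sat M m h (Prove j A)"
  shows "\<not> sat M m h' (Proven A)"
proof
  assume Proven: "sat M m h' (Proven A)"
  obtain h0 where "h0 \<in> H M m" using H_nonempty[OF assms(1)] by blast
  with Proven obtain t where "\<forall>h \<in> H M m. t \<in> Act M m h" "sat M m h (Just t A)" by auto
  with assms(2) show False by (auto simp del: sat.simps(6,7) simp: sat.simps(8))
qed

text \<open>Histories through \<open>m'\<close> are undivided at \<open>m\<close>, so they present
  the same proofs there, and these persist to \<open>m'\<close>.\<close>

lemma Act_settled:
  assumes "m \<in> Tree M" "m' \<in> Tree M" "lt M m m'" "m' \<in> h" "h \<in> H M m" "g \<in> H M m'"
  shows "Act M m h \<subseteq> Act M m' g"
proof -
  have g: "g \<in> H M m" using assms H_downward by (auto simp: lt_iff)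
  with assms have "Act M m h = Act M m g"
    by (intro presenting_new_proofs_makes_histories_divide) (auto simp: H_def)
  with Act_expansion[OF assms(2,1,3,6)] show ?thesis by simp
qed

text \<open>If \<open>h\<close> ended in \<open>m\<close>, it would be the only history through
  \<open>m\<close>. Its proof of \<open>A\<close> would then be presented on all histories, which
  the negative clause for \<open>Prove\<close> forbids.\<close>

lemma sat_Prove_later:
  assumes "m \<in> Tree M" "h \<in> H M m" "sat M m h (Prove j A)"
  shows "\<exists>m' \<in> h. lt M m m'"
proof (rule ccontr)
  assume "\<not> ?thesis"
  then have H: "H M m = {h}" using H_singleton[OF assms(2)] by blast
  obtain t where "t \<in> Act M m h" "sat M m h (Just t A)"
    using assms(3) cell_self[OF assms(1,2), of j] unfolding sat.simps(8) by blast
  with assms(3) H show False by (auto simp del: sat.simps(6,7) simp: sat.simps(8))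
qed

lemma sat_Prove_settled:
  assumes "m \<in> Tree M" "m' \<in> Tree M" "h \<in> H M m" "sat M m h (Prove j A)" "m' \<in> h" "lt M m m'"
  shows "sat M m' g (Proven A)"
proof -
  obtain t where t: "t \<in> Act M m h" "sat M m h (Just t A)"
    using assms(4) cell_self[OF assms(1,3), of j] unfolding sat.simps(8) by blast
  have "(m, m') \<in> Rel M" using assms(6) future_always_matters by (auto simp: lt_def)
  then have "sat M m' g (Just t A)" using sat_Just_mono assms(1,2) t(2) by blast
  then show ?thesis
    using Act_settled[OF assms(1,2,6,5,3)] t(1) by (auto simp del: sat.simps(6,7) simp: sat.simps(9))
qed

text \<open>Refutes the disjunction in A12. If a formula can still be proved at some accessible
  moment, going just beyond that proof makes it proven for good, and then it can never be in the
  course of being proved again. One such move disposes of one pair, and transitivity of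
  \<open>Rel\<close> keeps the earlier pairs disposed of.\<close>

lemma ex_exhausted:
  assumes "m \<in> Tree M"
  shows "\<exists>m' \<in> Tree M. (m, m') \<in> Rel M \<and>
    (\<forall>(j, A) \<in> set jAs. \<forall>m'' \<in> Tree M. (m', m'') \<in> Rel M \<longrightarrow> (\<forall>h \<in> H M m''. \<not> sat M m'' h (Prove j A)))"
proof (induction jAs)
  case Nil
  then show ?case using assms Rel_refl by auto
next
  case (Cons jA jAs)
  obtain j A where jA: "jA = (j, A)" by fastforce
  from Cons.IH obtain m' where m': "m' \<in> Tree M" "(m, m') \<in> Rel M"
    and IH: "\<forall>(j, A) \<in> set jAs. \<forall>m'' \<in> Tree M. (m', m'') \<in> Rel M \<longrightarrow>
      (\<forall>h \<in> H M m''. \<not> sat M m'' h (Prove j A))"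
    by (auto simp del: sat.simps)
  show ?case
  proof (cases "\<exists>m'' \<in> Tree M. (m', m'') \<in> Rel M \<and> (\<exists>h \<in> H M m''. sat M m'' h (Prove j A))")
    case False
    with m' IH jA show ?thesis by (intro bexI[of _ m']) (auto simp del: sat.simps)
  next
    case True
    then obtain m1 h where m1: "m1 \<in> Tree M" "(m', m1) \<in> Rel M" "h \<in> H M m1"
      and sat: "sat M m1 h (Prove j A)" by blast
    then obtain m2 where m2: "m2 \<in> h" "lt M m1 m2" using sat_Prove_later by blast
    then have T2: "m2 \<in> Tree M" using m1(3) Hist_subset by (auto simp: H_def)
    have R12: "(m1, m2) \<in> Rel M" using m2 future_always_matters by (auto simp: lt_def)
    have Proven: "sat M m2 g (Proven A)" for g
      using sat_Prove_settled[OF m1(1) T2 m1(3) sat m2] .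
    have "\<not> sat M m3 g (Prove j A)" if "m3 \<in> Tree M" "(m2, m3) \<in> Rel M" "g \<in> H M m3" for m3 g
      using sat_Prove_not_Proven[OF that(1)] sat_Proven_mono[OF T2 that(1,2) Proven] by blast
    moreover have "(m', m2) \<in> Rel M" using m1 R12 Rel_trans by blast
    moreover have "(m2, m3) \<in> Rel M \<Longrightarrow> (m', m3) \<in> Rel M" for m3
      using \<open>(m', m2) \<in> Rel M\<close> Rel_trans by blast
    moreover have "(m, m2) \<in> Rel M" using m' \<open>(m', m2) \<in> Rel M\<close> Rel_trans by blast
    ultimately show ?thesis using T2 IH jA
      by (intro bexI[of _ m2]) (auto simp del: sat.simps)
  qed
qed

lemma sound_A3:
  assumes m: "m \<in> Tree M" and h: "h \<in> H M m" and dist: "distinct (map fst jAs)"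
    and sat: "sat M m h (Conj (map (\<lambda>(j, A). Dia (Stit j A)) jAs))"
  shows "sat M m h (Dia (Conj (map (\<lambda>(j, A). Stit j A) jAs)))"
proof -
  have "\<forall>(j, A) \<in> set jAs. \<exists>h' \<in> H M m. \<forall>g \<in> cell M m j h'. sat M m g A"
    using sat by fastforce
  \<comment> \<open>Independence wants a history for every agent. Agents absent from
    \<open>jAs\<close> receive \<open>h\<close>; for the others, distinctness makes the formula
    unique.\<close>
  then have "\<exists>h'. h' \<in> H M m \<and> (\<forall>A. (j, A) \<in> set jAs \<longrightarrow> (\<forall>g \<in> cell M m j h'. sat M m g A))" for j
  proof (cases "\<exists>A. (j, A) \<in> set jAs")
    case True
    then obtain A where A: "(j, A) \<in> set jAs" by blast
    then have "B = A" if "(j, B) \<in> set jAs" for B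
      using that dist eq_key_imp_eq_value by fast
    with A show ?thesis
      using \<open>\<forall>(j, A) \<in> set jAs. _ j A\<close> by blast
  qed (use h in blast)
  then obtain f where f: "\<And>j. f j \<in> H M m"
    "\<And>j A. (j, A) \<in> set jAs \<Longrightarrow> \<forall>g \<in> cell M m j (f j). sat M m g A"
    by metis
  have "(\<Inter>j. cell M m j (f j)) \<noteq> {}"
    by (rule independence[OF m cell_Choice[OF m f(1)]])
  then obtain g where g: "\<And>j. g \<in> cell M m j (f j)" by blast
  then have "g \<in> H M m" using cell_subset[OF m f(1)] by blast
  moreover have "cell M m j g = cell M m j (f j)" for j
    using cell_eq[OF m f(1) g] .
  ultimately show ?thesis using f(2) by fastforce
qed

text \<open>The negative clause for \<open>Prove\<close> can fail only if \<open>A\<close> is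
  proven, and then nobody proves it at \<open>h\<close>. Otherwise the positive clause fails at some
  history of the cell that presents no proof of \<open>A\<close>; as this history belongs to its own
  cell for every agent, it refutes \<open>Prove i A\<close> for all \<open>i\<close>.\<close>

lemma sound_A13:
  assumes m: "m \<in> Tree M" and h: "h \<in> H M m" and nP: "\<not> sat M m h (Prove j A)"
  shows "\<exists>h' \<in> cell M m j h. \<forall>i. \<not> sat M m h' (Prove i A)"
proof (cases "sat M m h (Proven A)")
  case True
  then show ?thesis
    using cell_self[OF m h] sat_Prove_not_Proven[OF m] by blast
next
  case False
  then have "\<exists>h'' \<in> H M m. sat M m h (Just s A) \<longrightarrow> s \<notin> Act M m h''" for s
    using H_nonempty[OF m] by (auto simp del: sat.simps(6,7) simp: sat.simps(9))
  with nP obtain h' where h': "h' \<in> cell M m j h" "\<forall>t \<in> Act M m h'. \<not> sat M m h' (Just t A)"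
    by (auto simp del: sat.simps(6,7) simp: sat.simps(8))
  then have "h' \<in> H M m" using cell_subset[OF m h] by blast
  then have "h' \<in> cell M m i h'" for i by (rule cell_self[OF m])
  with h' have "\<not> sat M m h' (Prove i A)" for i unfolding sat.simps(8) by blast
  with h' show ?thesis by blast
qed

lemma axiom_sound:
  assumes "axiom A" and m: "m \<in> Tree M" and h: "h \<in> H M m"
  shows "sat M m h A"
  using assms(1)
proof cases
  case A0
  then have "bval (sat M m h) A" by (simp add: tautology_def)
  then show ?thesis by (simp only: bval_sat)
next
  case (A1_Box_T A)
  then show ?thesis using h by auto
next
  case (A1_Stit_T j A)
  then show ?thesis using cell_self[OF m h] by auto
next
  case (A1_Stit_4 A j)
  then show ?thesis using cell_eq[OF m h] by auto
next
  case (A1_Stit_5 j A)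
  then show ?thesis using cell_eq[OF m h] by auto
next
  case (A2 A j)
  then show ?thesis using cell_subset[OF m h] by auto
next
  case (A3 jAs)
  then show ?thesis using sound_A3[OF m h] by (simp del: sat_Conj)
next
  case (A4 s A B t)
  have "sat M m h (Just (App s t) B)" if "sat M m h (Just s (A \<^bold>\<rightarrow> B))" "sat M m h (Just t A)"
    using that Evid_App[OF m, of A B s t] by (simp only: sat.simps(2,3,6,7)) blast
  with A4 show ?thesis by (simp only: sat.simps(2,3)) blast
next
  case (A5 t A)
  have "sat M m h (Know (Just t A)) \<and> Just t A \<in> Evid M m (Bang t) \<and> sat M m h (Know A)"
    if J: "sat M m h (Just t A)"
  proof (intro conjI)
    show "sat M m h (Know (Just t A))"
      using sat_Just_mono[OF m _ _ J] by (simp only: sat.simps(6)) blast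
  qed (use J Evid_Bang[OF m] in auto)
  with A5 show ?thesis by (simp only: sat.simps(2,3,7)) blast
next
  case (A6 s A t)
  then show ?thesis using Evid_Sum[OF m, of s t] by (simp only: sat.simps(2,3,7)) blast
next
  case (A7_T A)
  then show ?thesis using Rel_refl[OF m] m h by auto
next
  case (A7_4 A)
  have "sat M m h (Know (Know A))" if "sat M m h (Know A)"
    using sat_Know_mono[OF _ that] by (simp only: sat.simps(6)) blast
  with A7_4 show ?thesis by (simp only: sat.simps(2,3)) blast
next
  case (A8 A)
  then show ?thesis by auto
next
  case (A9 j A)
  have "\<not> sat M m h (Proven A) \<and> sat M m h (Stit j (Prove j A)) \<and> sat M m h (Know A)"
    if P: "sat M m h (Prove j A)"
  proof (intro conjI)
    show "\<not> sat M m h (Proven A)" using sat_Prove_not_Proven[OF m P] .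
    show "sat M m h (Stit j (Prove j A))" using P cell_eq[OF m h] by auto
    show "sat M m h (Know A)" using P cell_self[OF m h] by auto
  qed
  with A9 show ?thesis by (simp del: sat.simps add: sat.simps(2,3))
next
  case (A10 j A i)
  \<comment> \<open>Only the positive clause for \<open>Prove\<close> depends on the agent. If it
    holds for \<open>j\<close> on all histories, then a proof is presented on all of them, in
    whatever cell of \<open>i\<close> they lie.\<close>
  have "sat M m g (Prove i A)" if P: "\<forall>g \<in> H M m. sat M m g (Prove j A)" and g: "g \<in> H M m" for g
  proof -
    have "\<exists>t \<in> Act M m g'. sat M m g' (Just t A)" if "g' \<in> cell M m i g" for g'
    proof -
      have "g' \<in> H M m" using that cell_subset[OF m g] by blast
      with P cell_self[OF m this, of j] show ?thesis unfolding sat.simps(8) by blast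
    qed
    with P g show ?thesis unfolding sat.simps(8) by blast
  qed
  with A10 show ?thesis by (simp only: sat.simps(2,3,5)) blast
next
  case (A11 A)
  have "sat M m h (Know (Proven A)) \<and> sat M m h (Know A)" if P: "sat M m h (Proven A)"
  proof
    show "sat M m h (Know (Proven A))"
      using sat_Proven_mono[OF m _ _ P] by (auto simp del: sat.simps simp: sat.simps(6))
    show "sat M m h (Know A)" using P h by auto
  qed
  with A11 show ?thesis by (simp del: sat.simps add: sat.simps(2,3))
next
  case (A12 jAs)
  from ex_exhausted[OF m, of jAs] obtain m' where m': "m' \<in> Tree M" "(m, m') \<in> Rel M"
    and none: "\<forall>(j, A) \<in> set jAs. \<forall>m'' \<in> Tree M. (m', m'') \<in> Rel M \<longrightarrow>
      (\<forall>h \<in> H M m''. \<not> sat M m'' h (Prove j A))"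
    by (auto simp del: sat.simps)
  obtain h' where "h' \<in> H M m'" using H_nonempty[OF m'(1)] by blast
  moreover have "\<not> sat M m' h' (Disj (map (\<lambda>(j, A). DiaK (Dia (Prove j A))) jAs))"
    using none by (auto simp del: sat.simps simp: sat.simps(3,5,6))
  ultimately show ?thesis
    using A12 m' by (auto simp del: sat.simps sat_Disj simp: sat.simps(3,6))
next
  case (A13 j A)
  show ?thesis unfolding A13 using sound_A13[OF m h, of j A]
    by (auto simp del: sat.simps simp: sat.simps(2,3,4) agents)
qed auto

lemma R4_sound:
  assumes valid: "\<And>m h. m \<in> Tree M \<Longrightarrow> h \<in> H M m \<Longrightarrow>
      sat M m h (Know A \<^bold>\<rightarrow> Disj (map (\<lambda>B. \<^bold>\<not> Proven B) Bs))"
    and "Bs \<noteq> []" and m: "m \<in> Tree M" and h: "h \<in> H M m"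
  shows "sat M m h (Know A \<^bold>\<rightarrow> Disj (map (\<lambda>B. Conj (map (\<lambda>j. \<^bold>\<not> Prove j B) agents)) Bs))"
proof (rule ccontr)
  assume "\<not> ?thesis"
  then have K: "sat M m h (Know A)" and P: "\<And>B. B \<in> set Bs \<Longrightarrow> \<exists>j. sat M m h (Prove j B)"
    by (auto simp del: sat.simps simp: sat.simps(2,3) agents)
  \<comment> \<open>Nonemptiness of \<open>Bs\<close> supplies one proof in progress and so a later
    moment on \<open>h\<close>; every other formula in \<open>Bs\<close> is settled at that same
    moment.\<close>
  from P[of "hd Bs"] \<open>Bs \<noteq> []\<close> obtain j where "sat M m h (Prove j (hd Bs))" by auto
  from sat_Prove_later[OF m h this] obtain m' where m': "m' \<in> h" "lt M m m'" by blast
  then have T: "m' \<in> Tree M" using h Hist_subset by (auto simp: H_def)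
  have "(m, m') \<in> Rel M" using m' future_always_matters by (auto simp: lt_def)
  then have "sat M m' h (Know A)" using sat_Know_mono K by blast
  moreover have "h \<in> H M m'" using m' h by (auto simp: H_def)
  moreover have "sat M m' h (Proven B)" if "B \<in> set Bs" for B
    using P[OF that] sat_Prove_settled[OF m T h _ m'] by blast
  ultimately show False
    using valid[OF T, of h] by (auto simp del: sat.simps simp: sat.simps(2,3))
qed

lemma sound:
  assumes "\<turnstile> A" "normal M" "m \<in> Tree M" "h \<in> H M m"
  shows "sat M m h A"
  using assms(1,3,4)
proof (induction A arbitrary: m h rule: derivable_induct)
  case (axiom A)
  then show ?case by (rule axiom_sound)
next
  case (rule S A)
  from rule.hyps show ?case
  proof cases
    case (R1 B)
    with rule.IH[OF R1(1) rule.prems] rule.IH[OF R1(2) rule.prems] show ?thesis by simp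
  next
    case (R2 B)
    with rule.IH[OF R2(2)] show ?thesis by simp
  next
    case (R3 B c)
    with assms(2) rule.prems axiom_sound show ?thesis by (auto simp: normal_def)
  next
    case (R4 Bs B)
    show ?thesis unfolding R4
      using R4_sound[of B Bs m h] rule.IH[OF R4(3)] R4(2) rule.prems by blast
  qed
qed

end

theorem soundness: "\<turnstile> A \<Longrightarrow> valid_normal TYPE('m) A"
  using jstit_model.sound by (auto simp: valid_normal_def MH_def)

section \<open>Knowledge and proving in maximal consistent sets\<close>

lemma mcs_Know_box:
  assumes "mcs \<Gamma>" "Know A \<in> \<Gamma>"
  shows "Know (Box A) \<in> \<Gamma>"
  using mcs_axiom[OF assms(1) A8[of A]] mcs_axiom[OF assms(1) A1_Box_T[of "Know (Box A)"]] assms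
  by simp

lemma mcs_Know_Know: "mcs \<Gamma> \<Longrightarrow> Know A \<in> \<Gamma> \<Longrightarrow> Know (Know A) \<in> \<Gamma>"
  using mcs_axiom[OF _ A7_4[of A]] by fastforce

lemma mcs_Know_T: "mcs \<Gamma> \<Longrightarrow> Know A \<in> \<Gamma> \<Longrightarrow> A \<in> \<Gamma>"
  using mcs_axiom[OF _ A7_T[of A]] by fastforce

text \<open>A8 makes knowledge independent of the history: it places \<open>Know (Box A)\<close>
  under a \<open>Box\<close>, whence it reaches every box-equivalent set.\<close>

lemma sim_Box_Know:
  assumes "mcs \<Gamma>" "mcs \<Delta>" "sim Box \<Gamma> \<Delta>" "Know A \<in> \<Gamma>"
  shows "Know A \<in> \<Delta>"
proof -
  have "Box (Know (Box A)) \<in> \<Gamma>" using mcs_axiom[OF assms(1) A8[of A]] assms(1,4) by simp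
  then have "Know (Box A) \<in> \<Delta>" using sim_sub[OF S5_op_Box assms(3,2)] by blast
  then show ?thesis
    using normal_op_mono[OF normal_op_Know assms(2)] derivable_axiom[OF A1_Box_T] by blast
qed

text \<open>Meant for \<open>Just\<close> and \<open>Proven\<close>, which imply their own
  knowledge. They thus belong to the moment rather than to a history, and may be looked up in
  \<open>rep m\<close> or in any choice made after \<open>m\<close>.\<close>

lemma Know_sim_iff:
  assumes "mcs \<Gamma>" "mcs \<Delta>" "sim Box \<Gamma> \<Delta>" and Know: "\<And>\<Gamma>. mcs \<Gamma> \<Longrightarrow> A \<in> \<Gamma> \<Longrightarrow> Know A \<in> \<Gamma>"
  shows "A \<in> \<Gamma> \<longleftrightarrow> A \<in> \<Delta>"
proof -
  have "sim Box \<Delta> \<Gamma>" using assms(3) sim_sym by blast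
  then show ?thesis
    using assms(1,2,3) sim_Box_Know[OF assms(1,2)] sim_Box_Know[OF assms(2,1)] Know mcs_Know_T
    by blast
qed

lemma mcs_Just:
  assumes "mcs \<Gamma>" "Just t A \<in> \<Gamma>"
  shows "Know A \<in> \<Gamma>" "Just (Bang t) (Just t A) \<in> \<Gamma>" "Know (Just t A) \<in> \<Gamma>"
proof -
  have "Just (Bang t) (Just t A) \<in> \<Gamma> \<and> Know A \<in> \<Gamma>" if "Just t A \<in> \<Gamma>" for t A
    using mcs_axiom[OF assms(1) A5[of t A]] assms(1) that by simp
  with assms(2) show "Know A \<in> \<Gamma>" "Just (Bang t) (Just t A) \<in> \<Gamma>" "Know (Just t A) \<in> \<Gamma>"
    by blast+
qed

lemma mcs_Proven:
  assumes "mcs \<Gamma>" "Proven A \<in> \<Gamma>"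
  shows "Know A \<in> \<Gamma>" "Know (Proven A) \<in> \<Gamma>"
  using mcs_axiom[OF assms(1) A11[of A]] assms by simp_all

lemma mcs_Prove:
  assumes "mcs \<Gamma>" "Prove j A \<in> \<Gamma>"
  shows "Know A \<in> \<Gamma>" "Proven A \<notin> \<Gamma>" "Stit j (Prove j A) \<in> \<Gamma>"
  using mcs_axiom[OF assms(1) A9[of j A]] assms by simp_all

text \<open>The use of A13. The set found here later becomes a history in the cell of
  \<open>j\<close> on which no agent is proving \<open>A\<close>.\<close>

lemma mcs_not_Prove:
  assumes "mcs \<Gamma>" "Prove j A \<notin> \<Gamma>"
  shows "\<exists>\<Delta>. mcs \<Delta> \<and> sim (Stit j) \<Gamma> \<Delta> \<and> (\<forall>i. Prove i A \<notin> \<Delta>)"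
proof -
  let ?C = "Conj (map (\<lambda>i. \<^bold>\<not> Prove i A) agents)"
  have "Stit j (\<^bold>\<not> ?C) \<notin> \<Gamma>"
    using mcs_axiom[OF assms(1) A13[of j A]] assms by (simp del: mcs_Conj)
  from sim_existence[OF S5_op_Stit assms(1) this] obtain \<Delta>
    where \<Delta>: "mcs \<Delta>" "sim (Stit j) \<Gamma> \<Delta>" "\<^bold>\<not> ?C \<notin> \<Delta>" by blast
  then have "\<forall>i. Prove i A \<notin> \<Delta>" by (simp add: agents)
  with \<Delta> show ?thesis by blast
qed

lemma sim_Stit_Box:
  assumes "mcs \<Gamma>" "mcs \<Delta>" "sim (Stit j) \<Gamma> \<Delta>"
  shows "sim Box \<Gamma> \<Delta>"
proof (rule simI[OF S5_op_Box assms(1,2)])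
  fix A assume "Box A \<in> \<Gamma>"
  then have "Stit j A \<in> \<Gamma>" using mcs_axiom[OF assms(1) A2[of A j]] assms(1) by simp
  then show "A \<in> \<Delta>" using sim_sub[OF S5_op_Stit assms(3,2)] by blast
qed

text \<open>A refutation involves finitely many formulas. Those of agent \<open>j\<close> are
  collected in a single \<open>Stit j (B j)\<close>, so that A3, which admits one formula per agent,
  applies.\<close>

lemma mcs_independence:
  fixes \<Gamma> :: "'ag::finite \<Rightarrow> 'ag form set"
  assumes \<Delta>: "mcs \<Delta>" and \<Gamma>: "\<And>j. mcs (\<Gamma> j)" "\<And>j. sim Box \<Delta> (\<Gamma> j)"
  shows "\<exists>\<Theta>. mcs \<Theta> \<and> sim Box \<Delta> \<Theta> \<and> (\<forall>j. sim (Stit j) (\<Gamma> j) \<Theta>)"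
proof -
  let ?S = "\<Union>j. {Stit j A | A. Stit j A \<in> \<Gamma> j}"
  have "consistent ?S"
    unfolding consistent_def
  proof
    assume "\<exists>As. set As \<subseteq> ?S \<and> \<turnstile> Imps As \<^bold>\<bottom>"
    then obtain As where As: "set As \<subseteq> ?S" "\<turnstile> Imps As \<^bold>\<bottom>" by blast
    have "\<exists>B. Stit j B \<in> \<Gamma> j \<and>
        (\<forall>\<Theta> A. mcs \<Theta> \<longrightarrow> Stit j B \<in> \<Theta> \<longrightarrow> Stit j A \<in> set As \<longrightarrow> Stit j A \<in> \<Theta>)" for j
    proof -
      have "finite {A. Stit j A \<in> set As}"
        by (rule finite_subset[OF _ finite_vimageI[of "set As" "Stit j"]]) (auto simp: inj_def)
      then obtain Bs where Bs: "set Bs = {A. Stit j A \<in> set As}" using finite_list by blast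
      have "\<forall>A \<in> set Bs. Stit j A \<in> \<Gamma> j" using As(1) Bs by auto
      then have "Stit j (Conj Bs) \<in> \<Gamma> j"
        using normal_op_Conj[OF normal_op_Stit \<Gamma>(1)] by blast
      moreover have "Stit j A \<in> \<Theta>" if "mcs \<Theta>" "Stit j (Conj Bs) \<in> \<Theta>" "Stit j A \<in> set As" for \<Theta> A
        using that normal_op_Conj[OF normal_op_Stit that(1)] Bs by blast
      ultimately show ?thesis by blast
    qed
    then obtain B where B: "\<And>j. Stit j (B j) \<in> \<Gamma> j"
      "\<And>j \<Theta> A. mcs \<Theta> \<Longrightarrow> Stit j (B j) \<in> \<Theta> \<Longrightarrow> Stit j A \<in> set As \<Longrightarrow> Stit j A \<in> \<Theta>"
      by metis
    let ?js = "map (\<lambda>j. (j, B j)) (agents :: 'ag list)"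
    have "Dia (Stit j (B j)) \<in> \<Delta>" for j
    proof -
      have "Box (\<^bold>\<not> Stit j (B j)) \<notin> \<Delta>"
        using sim_sub[OF S5_op_Box \<Gamma>(2,1), of "\<^bold>\<not> Stit j (B j)" j] B(1) \<Gamma>(1) by auto
      then show ?thesis using \<Delta> by simp
    qed
    then have "Conj (map (\<lambda>(j, A). Dia (Stit j A)) ?js) \<in> \<Delta>"
      using \<Delta> by (auto simp del: mcs_Neg)
    moreover have "distinct (map fst ?js)" using agents by (simp add: comp_def)
    moreover have "?js \<noteq> []" using agents(2) UNIV_not_empty by (metis list.map_disc_iff set_empty)
    ultimately have "Dia (Conj (map (\<lambda>(j, A). Stit j A) ?js)) \<in> \<Delta>"
      using mcs_axiom[OF \<Delta> A3[of ?js]] \<Delta> by (simp del: mcs_Conj)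
    then have "Box (\<^bold>\<not> Conj (map (\<lambda>(j, A). Stit j A) ?js)) \<notin> \<Delta>" using \<Delta> by (simp del: mcs_Conj)
    from sim_existence[OF S5_op_Box \<Delta> this] obtain \<Theta>
      where \<Theta>: "mcs \<Theta>" "\<^bold>\<not> Conj (map (\<lambda>(j, A). Stit j A) ?js) \<notin> \<Theta>" by blast
    then have "Stit j (B j) \<in> \<Theta>" for j by (auto simp: agents)
    then have "set As \<subseteq> \<Theta>" using As(1) B(2)[OF \<Theta>(1)] by blast
    with As(2) \<Theta>(1) show False by (auto simp: mcs_def consistent_def)
  qed
  then obtain \<Theta> where \<Theta>: "mcs \<Theta>" "?S \<subseteq> \<Theta>" using lindenbaum by blast
  have Stit: "sim (Stit j) (\<Gamma> j) \<Theta>" for j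
  proof (rule simI[OF S5_op_Stit \<Gamma>(1) \<Theta>(1)])
    fix A assume "Stit j A \<in> \<Gamma> j"
    then have "Stit j A \<in> \<Theta>" using \<Theta>(2) by blast
    then show "A \<in> \<Theta>" by (rule S5_T[OF S5_op_Stit \<Theta>(1)])
  qed
  then have "sim Box \<Delta> \<Theta>"
    using \<Gamma>(2) sim_Stit_Box[OF \<Gamma>(1) \<Theta>(1) Stit] by (auto simp: sim_def)
  with \<Theta> Stit show ?thesis by blast
qed

section \<open>Consistency of the next moment\<close>

definition updates :: "'ag::finite form set \<Rightarrow> 'ag form set \<Rightarrow> bool" where
  "updates \<Gamma> \<Delta> \<longleftrightarrow> mcs \<Delta> \<and> (\<forall>A. Know A \<in> \<Gamma> \<longrightarrow> A \<in> \<Delta>) \<and> (\<forall>j A. Prove j A \<in> \<Gamma> \<longrightarrow> Proven A \<in> \<Delta>)"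

lemma ex_updates:
  assumes "mcs \<Gamma>"
  shows "\<exists>\<Delta>. updates \<Gamma> \<Delta>"
proof -
  let ?K = "{Know A | A. Know A \<in> \<Gamma>}" and ?P = "{Proven A | A j. Prove j A \<in> \<Gamma>}"
  have "consistent (?K \<union> ?P)"
    unfolding consistent_def
  proof
    assume "\<exists>As. set As \<subseteq> ?K \<union> ?P \<and> \<turnstile> Imps As \<^bold>\<bottom>"
    then obtain As where As: "set As \<subseteq> ?K \<union> ?P" "\<turnstile> Imps As \<^bold>\<bottom>" by blast
    have "finite {A. Know A \<in> set As}"
      by (rule finite_subset[OF _ finite_vimageI[of "set As" Know]]) (auto simp: inj_def)
    then obtain Cs where Cs: "set Cs = {A. Know A \<in> set As}" using finite_list by blast
    have "finite {A. Proven A \<in> set As}"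
      by (rule finite_subset[OF _ finite_vimageI[of "set As" Proven]]) (auto simp: inj_def)
    then obtain Bs where Bs: "set Bs = {A. Proven A \<in> set As}" using finite_list by blast
    have "\<forall>A \<in> set Cs. Know A \<in> \<Gamma>" using As(1) Cs by auto
    then have C: "Know (Conj Cs) \<in> \<Gamma>" using normal_op_Conj[OF normal_op_Know assms] by blast
    have CK: "\<turnstile> Know (Conj Cs) \<^bold>\<rightarrow> Know A" if "A \<in> set Cs" for A
    proof -
      have "\<turnstile> Imps [Conj Cs] A" by (rule derivable_taut[of "[]"]) (use that in auto)
      from normal_op_Imps[OF normal_op_Know this] show ?thesis by simp
    qed
    \<comment> \<open>The refutation is rewritten as the premise of R4, with all \<open>Know\<close>
      formulas gathered in one conjunction \<open>Cs\<close>.\<close>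
    have D: "\<turnstile> Know (Conj Cs) \<^bold>\<rightarrow> Disj (map (\<lambda>B. \<^bold>\<not> Proven B) Bs)"
    proof (rule derivable_taut[of "Imps As \<^bold>\<bottom> # map (\<lambda>A. Know (Conj Cs) \<^bold>\<rightarrow> Know A) Cs"])
      fix v
      assume v: "\<forall>B \<in> set (Imps As \<^bold>\<bottom> # map (\<lambda>A. Know (Conj Cs) \<^bold>\<rightarrow> Know A) Cs). bval v B"
      then obtain A where A: "A \<in> set As" "\<not> bval v A" by auto
      with As(1) consider B where "A = Know B" | B where "A = Proven B" by blast
      then show "bval v (Know (Conj Cs) \<^bold>\<rightarrow> Disj (map (\<lambda>B. \<^bold>\<not> Proven B) Bs))"
      proof cases
        case 1
        with A Cs have "B \<in> set Cs" by simp
        with v have "bval v (Know (Conj Cs) \<^bold>\<rightarrow> Know B)" by simp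
        with 1 A show ?thesis by simp
      next
        case 2
        with A Bs have "B \<in> set Bs" by simp
        with 2 A show ?thesis by auto
      qed
    qed (use As CK in auto)
    show False
    \<comment> \<open>R4 asks for a nonempty list. For the empty one the disjunction is Falsum, and
      \<open>Know (Conj Cs)\<close> contradicts the consistency of \<Gamma> directly. Otherwise R4
      yields a member of \<open>Bs\<close> that nobody proves in \<Gamma>, although every member
      comes from some \<open>Prove j B\<close> in \<Gamma>.\<close>
    proof (cases "Bs = []")
      case True
      then show False using mcs_derivable[OF assms D] C assms by simp
    next
      case False
      have "Disj (map (\<lambda>B. Conj (map (\<lambda>j. \<^bold>\<not> Prove j B) agents)) Bs) \<in> \<Gamma>"
        using mcs_derivable[OF assms derivable_R4[OF False D]] C assms
        by (simp del: mcs_Conj mcs_Disj)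
      then obtain B where "B \<in> set Bs" "\<forall>j. Prove j B \<notin> \<Gamma>"
        using assms by (auto simp: agents)
      then show False using Bs As(1) by auto
    qed
  qed
  then obtain \<Delta> where \<Delta>: "mcs \<Delta>" "?K \<union> ?P \<subseteq> \<Delta>" using lindenbaum by blast
  then have "updates \<Gamma> \<Delta>" unfolding updates_def using mcs_Know_T[OF \<Delta>(1)] by blast
  then show ?thesis ..
qed

instance pol :: countable
  by countable_datatype

instance form :: (countable) countable
  by countable_datatype

section \<open>The tree of the canonical model\<close>

type_synonym 'ag node = "('ag form set \<times> bool) list"

text \<open>The universe of moments offers lists of formula sets paired with one number, so the bits
  are split off and coded together; the singleton lifts the pair to the outer set type.\<close>

definition enc :: "'ag node \<Rightarrow> 'ag moments" where
  "enc m = {(map fst m, to_nat (map snd m))}"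

definition dec :: "'ag moments \<Rightarrow> 'ag node" where
  "dec = inv enc"

lemma inj_enc: "inj enc"
  by (auto simp: inj_def enc_def intro: pair_list_eqI)

lemma enc_eq_iff [simp]: "enc m = enc m' \<longleftrightarrow> m = m'"
  using inj_enc by (auto simp: inj_def)

lemma dec_enc [simp]: "dec (enc m) = m"
  by (simp add: dec_def inj_enc)

definition update :: "'ag::finite form set \<Rightarrow> 'ag form set" where
  "update \<Gamma> = (SOME \<Delta>. updates \<Gamma> \<Delta>)"

lemma updates_update: "mcs \<Gamma> \<Longrightarrow> updates \<Gamma> (update \<Gamma>)"
  unfolding update_def by (rule someI_ex[OF ex_updates])

text \<open>A nonempty node lists an initial set and then the successive choices made; each choice
  carries a bit, so that every choice is available in two copies leading to divided histories.
  Above the root, a node stands for the box-equivalence class of \<^term>\<open>rep\<close>. The value on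
  the root is junk.\<close>

definition rep :: "'ag::finite node \<Rightarrow> 'ag form set" where
  "rep m = (if length m = 1 then fst (hd m) else update (fst (last m)))"

definition ext :: "'ag::finite node \<Rightarrow> ('ag form set \<times> bool) set" where
  "ext m = {(\<Gamma>, i). mcs \<Gamma> \<and> (m \<noteq> [] \<longrightarrow> sim Box (rep m) \<Gamma>)}"

inductive_set nodes :: "'ag::finite node set" where
  Nil: "[] \<in> nodes"
| snoc: "m \<in> nodes \<Longrightarrow> g \<in> ext m \<Longrightarrow> m @ [g] \<in> nodes"

lemma nodes_snoc [simp]: "m @ [g] \<in> nodes \<longleftrightarrow> m \<in> nodes \<and> g \<in> ext m"
  by (auto intro: nodes.snoc elim: nodes.cases)

lemma nodes_prefix: "m @ m' \<in> nodes \<Longrightarrow> m \<in> nodes"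
  by (induction m' rule: rev_induct) (auto simp flip: append_assoc)

lemma nodes_step:
  assumes "m' \<in> nodes" "strict_prefix m m'"
  obtains g where "m @ [g] \<in> nodes" "prefix (m @ [g]) m'"
proof -
  obtain g gs where m': "m' = (m @ [g]) @ gs"
    using assms(2) by (auto elim!: strict_prefixE')
  then have "m @ [g] \<in> nodes" using assms(1) nodes_prefix[of "m @ [g]" gs] by simp
  moreover have "prefix (m @ [g]) m'" using m' by (simp add: prefix_def)
  ultimately show ?thesis by (rule that)
qed

lemma rep_mcs:
  assumes "m \<in> nodes" "m \<noteq> []"
  shows "mcs (rep m)"
  using assms(1)
proof cases
  case (snoc m' g)
  then have "mcs (fst g)" by (auto simp: ext_def)
  with snoc show ?thesis using updates_update by (auto simp: rep_def updates_def)
qed (use assms in simp)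

text \<open>Only the tree is fixed here, the other fields being placeholders. Choices, presented
  proofs and the valuation will be defined in terms of histories, which the tree already
  determines.\<close>

definition cframe :: "('ag::finite, 'ag moments) jstit" where
  "cframe = \<lparr>Tree = enc ` nodes,
     Ord = {(enc m, enc m') | m m'. m \<in> nodes \<and> m' \<in> nodes \<and> prefix m m'},
     Choice = \<lambda>_ _. {}, Act = \<lambda>_ _. {}, Rel = {}, Evid = \<lambda>_ _. {}, Val = \<lambda>_. {}\<rparr>"

lemma Tree_cframe: "Tree cframe = enc ` nodes"
  by (simp add: cframe_def)

lemma le_cframe: "le cframe (enc m) (enc m') \<longleftrightarrow> m \<in> nodes \<and> m' \<in> nodes \<and> prefix m m'"
  by (auto simp: le_def cframe_def)

interpretation cframe: jstit_frame cframe
proof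
  have "antisym (Ord cframe)"
  proof (rule antisymI)
    fix x y assume "(x, y) \<in> Ord cframe" "(y, x) \<in> Ord cframe"
    then obtain m m' where "x = enc m" "y = enc m'" "prefix m m'" "prefix m' m"
      by (auto simp: cframe_def simp del: subset_antisym)
    then show "x = y" using prefix_order.antisym by blast
  qed
  moreover have "trans (Ord cframe)"
    unfolding trans_def cframe_def by (auto intro: prefix_order.trans)
  moreover have "refl_on (Tree cframe) (Ord cframe)" "Ord cframe \<subseteq> Tree cframe \<times> Tree cframe"
    by (auto simp: refl_on_def cframe_def)
  ultimately show "partial_order_on (Tree cframe) (Ord cframe)"
    by (auto simp: partial_order_on_def preorder_on_def)
next
  fix m m1 m2
  assume "m \<in> Tree cframe" "m1 \<in> Tree cframe" "m2 \<in> Tree cframe" "le cframe m1 m" "le cframe m2 m"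
  then show "le cframe m1 m2 \<or> le cframe m2 m1"
    by (auto simp: Tree_cframe le_cframe dest: prefix_same_cases)
qed

definition next_choice :: "'ag::finite node \<Rightarrow> 'ag moments set \<Rightarrow> 'ag form set \<times> bool" where
  "next_choice m h = (THE g. m @ [g] \<in> nodes \<and> enc (m @ [g]) \<in> h)"

text \<open>The set \<open>\<Gamma>0\<close> witnesses that the root has extensions; the tree itself
  does not depend on it.\<close>

locale canonical =
  fixes \<Gamma>0 :: "'ag::finite form set"
  assumes mcs_\<Gamma>0: "mcs \<Gamma>0"
begin

lemma ext_nonempty:
  assumes "m \<in> nodes"
  shows "\<exists>g. (g :: 'ag form set \<times> bool) \<in> ext m"
proof (cases "m = []")
  case True
  then show ?thesis using mcs_\<Gamma>0 by (auto simp: ext_def)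
next
  case False
  then have "(rep m, True) \<in> ext m" using rep_mcs[OF assms] by (auto simp: ext_def sim_def)
  then show ?thesis ..
qed

lemma next_choice:
  fixes m :: "'ag node"
  assumes m: "m \<in> nodes" and h: "h \<in> H cframe (enc m)"
  shows next_choice_ext: "next_choice m h \<in> ext m"
    and next_choice_eq: "enc (m @ [g]) \<in> h \<Longrightarrow> next_choice m h = g"
proof -
  have hist: "h \<in> Hist cframe" "enc m \<in> h" using h by (auto simp: H_def)
  have ex: "\<exists>g \<in> ext m. enc (m @ [g]) \<in> h"
  proof (cases "\<exists>m' \<in> nodes. enc m' \<in> h \<and> strict_prefix m m'")
    case True
    then obtain m' where m': "m' \<in> nodes" "enc m' \<in> h" "strict_prefix m m'" by blast
    then obtain g where g: "m @ [g] \<in> nodes" "prefix (m @ [g]) m'"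
      using nodes_step by blast
    with m' hist have "enc (m @ [g]) \<in> h"
      by (intro cframe.Hist_downward[OF hist(1) m'(2)]) (simp_all add: Tree_cframe le_cframe)
    with \<open>m @ [g] \<in> nodes\<close> show ?thesis by auto
  next
    case False
    obtain g where g: "g \<in> ext m" using ext_nonempty[OF m] by blast
    \<comment> \<open>Histories never end: if \<open>h\<close> stopped at \<open>m\<close>, any
      extension of \<open>m\<close> would be comparable with all of \<open>h\<close>, hence in
      \<open>h\<close> by maximality.\<close>
    have "enc (m @ [g]) \<in> h"
    proof (rule cframe.Hist_maximal[OF hist(1)], use m g in \<open>simp add: Tree_cframe\<close>, rule ballI)
      fix x assume x: "x \<in> h"
      then obtain m' where m': "m' \<in> nodes" "x = enc m'"
        using cframe.Hist_subset[OF hist(1)] by (auto simp: Tree_cframe)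
      from cframe.Hist_total[OF hist x] False m' x have "prefix m' m"
        by (auto simp: le_cframe strict_prefix_def)
      then show "le cframe (enc (m @ [g])) x \<or> le cframe x (enc (m @ [g]))"
        using m m' g by (auto simp: le_cframe)
    qed
    with g show ?thesis by blast
  qed
  have unique: "g = g'" if "enc (m @ [g]) \<in> h" "enc (m @ [g']) \<in> h" for g g'
    using cframe.Hist_total[OF hist(1) that] by (auto simp: le_cframe)
  have node: "m @ [g] \<in> nodes" if "enc (m @ [g]) \<in> h" for g
    using that cframe.Hist_subset[OF hist(1)] by (auto simp: Tree_cframe simp del: nodes_snoc)
  have eq: "next_choice m h = g" if "enc (m @ [g]) \<in> h" for g
    unfolding next_choice_def using that unique node by (intro the_equality) blast+
  with ex show "next_choice m h \<in> ext m" by auto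
  show "next_choice m h = g" if "enc (m @ [g]) \<in> h" by (rule eq[OF that])
qed

lemma ex_next_choice:
  fixes m :: "'ag node"
  assumes "m \<in> nodes" "g \<in> ext m"
  shows "\<exists>h \<in> H cframe (enc m). next_choice m h = g"
proof -
  have "m @ [g] \<in> nodes" using assms by simp
  then obtain h where h: "h \<in> H cframe (enc (m @ [g]))"
    using cframe.H_nonempty[of "enc (m @ [g])"] by (auto simp: Tree_cframe simp del: nodes_snoc)
  then have "h \<in> H cframe (enc m)"
    using assms by (intro cframe.H_downward[OF h]) (auto simp: Tree_cframe le_cframe)
  moreover have "next_choice m h = g"
    using h by (intro next_choice_eq[OF assms(1) calculation]) (simp add: H_def)
  ultimately show ?thesis by blast
qed

lemma next_choice_later:
  fixes m :: "'ag node"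
  assumes "m \<in> nodes" "m' \<in> nodes" "h \<in> H cframe (enc m)" "strict_prefix m m'" "enc m' \<in> h"
  shows "prefix (m @ [next_choice m h]) m'"
proof -
  obtain g where g: "m @ [g] \<in> nodes" "prefix (m @ [g]) m'"
    using nodes_step assms(2,4) by blast
  then have "enc (m @ [g]) \<in> h"
    using assms
    by (intro cframe.Hist_downward[OF _ assms(5)]) (simp_all add: H_def Tree_cframe le_cframe)
  then show ?thesis using next_choice_eq[OF assms(1,3)] g by simp
qed

end

section \<open>The canonical model\<close>

primrec old_pol :: "nat \<Rightarrow> pol \<Rightarrow> bool" where
  "old_pol N (PVar n) \<longleftrightarrow> n < N"
| "old_pol N (PConst c) \<longleftrightarrow> True"
| "old_pol N (Sum s t) \<longleftrightarrow> old_pol N s \<and> old_pol N t"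
| "old_pol N (App s t) \<longleftrightarrow> old_pol N s \<and> old_pol N t"
| "old_pol N (Bang t) \<longleftrightarrow> old_pol N t"

primrec old :: "nat \<Rightarrow> 'ag form \<Rightarrow> bool" where
  "old N (Atom p) \<longleftrightarrow> True"
| "old N (A \<^bold>\<and> B) \<longleftrightarrow> old N A \<and> old N B"
| "old N (\<^bold>\<not> A) \<longleftrightarrow> old N A"
| "old N (Stit j A) \<longleftrightarrow> old N A"
| "old N (Box A) \<longleftrightarrow> old N A"
| "old N (Just t A) \<longleftrightarrow> old_pol N t \<and> old N A"
| "old N (Know A) \<longleftrightarrow> old N A"
| "old N (Prove j A) \<longleftrightarrow> old N A"
| "old N (Proven A) \<longleftrightarrow> old N A"

lemma old_pol_mono: "old_pol N t \<Longrightarrow> N \<le> N' \<Longrightarrow> old_pol N' t"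
  by (induction t) auto

lemma old_mono: "old N A \<Longrightarrow> N \<le> N' \<Longrightarrow> old N' A"
  by (induction A) (auto intro: old_pol_mono)

lemma ex_old_pol: "\<exists>N. old_pol N t"
proof (induction t)
  case (PVar n)
  have "old_pol (Suc n) (PVar n)" by simp
  then show ?case ..
next
  case (Sum s t)
  then obtain N N' where "old_pol N s" "old_pol N' t" by blast
  then have "old_pol (max N N') (Sum s t)" by (auto intro: old_pol_mono)
  then show ?case ..
next
  case (App s t)
  then obtain N N' where "old_pol N s" "old_pol N' t" by blast
  then have "old_pol (max N N') (App s t)" by (auto intro: old_pol_mono)
  then show ?case ..
qed auto

lemma ex_old: "\<exists>N. old N A"
proof (induction A)
  case (And A B)
  then obtain N N' where "old N A" "old N' B" by blast
  then have "old (max N N') (A \<^bold>\<and> B)" by (auto intro: old_mono)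
  then show ?case ..
next
  case (Just t A)
  then obtain N N' where "old_pol N t" "old N' A" using ex_old_pol by blast
  then have "old (max N N') (Just t A)" by (auto intro: old_mono old_pol_mono)
  then show ?case ..
qed auto

text \<open>Proof variables with index at least \<^term>\<open>N\<close> do not occur in the refuted formula.
  \<open>xvar N A i b\<close> is presented when \<^term>\<open>A\<close> is being proved on a history
  with bit \<^term>\<open>i\<close>, hence by no single proof on all histories; \<open>yvar N b\<close> is
  presented from the start and becomes evidence for \<^term>\<open>A\<close> only where \<^term>\<open>Proven A\<close>
  holds. The bit \<^term>\<open>b\<close> of the initial set keeps anything from being settled at the root.\<close>

definition yvar :: "nat \<Rightarrow> bool \<Rightarrow> pol" where
  "yvar N b = PVar (N + of_bool b)"

definition xvar :: "nat \<Rightarrow> 'ag::finite form \<Rightarrow> bool \<Rightarrow> bool \<Rightarrow> pol" where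
  "xvar N A i b = PVar (N + 2 + to_nat (A, i, b))"

lemma var_simps [simp]:
  "yvar N b = yvar N b' \<longleftrightarrow> b = b'"
  "xvar N A i b = xvar N A' i' b' \<longleftrightarrow> A = A' \<and> i = i' \<and> b = b'"
  "yvar N b \<noteq> xvar N A i b'" "xvar N A i b' \<noteq> yvar N b"
  "\<not> old_pol N (yvar N b)" "\<not> old_pol N (xvar N A i b)"
  by (auto simp: yvar_def xvar_def of_bool_def)

text \<open>Compound polynomials containing a fresh variable are never presented, so they may be
  evidence for everything, which makes the closure conditions hold.\<close>

definition evid :: "nat \<Rightarrow> 'ag::finite form set \<Rightarrow> pol \<Rightarrow> 'ag form set" where
  "evid N \<Gamma> t =
    (if old_pol N t then {A. Just t A \<in> \<Gamma>}
     else case t of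
       PVar n \<Rightarrow> {A. (Proven A \<in> \<Gamma> \<and> (\<exists>b. t = yvar N b)) \<or> (\<exists>i b. t = xvar N A i b)}
     | _ \<Rightarrow> UNIV)"

lemma evid_old: "old_pol N t \<Longrightarrow> evid N \<Gamma> t = {A. Just t A \<in> \<Gamma>}"
  by (simp add: evid_def)

lemma evid_yvar [simp]: "evid N \<Gamma> (yvar N b) = {A. Proven A \<in> \<Gamma>}"
proof -
  have "\<exists>n. yvar N b = PVar n" by (simp add: yvar_def)
  then obtain n where n: "yvar N b = PVar n" ..
  have "\<not> old_pol N (yvar N b)" by simp
  moreover have "(case yvar N b of PVar n \<Rightarrow> S | _ \<Rightarrow> UNIV) = S" for S :: "'a form set"
    by (simp add: n)
  ultimately show ?thesis unfolding evid_def by auto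
qed

lemma evid_xvar [simp]: "evid N \<Gamma> (xvar N A i b) = {A}"
proof -
  have "\<exists>n. xvar N A i b = PVar n" by (simp add: xvar_def)
  then obtain n where n: "xvar N A i b = PVar n" ..
  have "\<not> old_pol N (xvar N A i b)" by simp
  moreover have "(case xvar N A i b of PVar n \<Rightarrow> S | _ \<Rightarrow> UNIV) = S" for S :: "'a form set"
    by (simp add: n)
  ultimately show ?thesis unfolding evid_def by auto
qed

lemma evid_App:
  assumes "mcs \<Gamma>" "(A \<^bold>\<rightarrow> B) \<in> evid N \<Gamma> s" "A \<in> evid N \<Gamma> t"
  shows "B \<in> evid N \<Gamma> (App s t)"
proof (cases "old_pol N (App s t)")
  case True
  then show ?thesis
    using assms mcs_axiom[OF assms(1) A4[of s A B t]] by (simp add: evid_old)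
qed (auto simp: evid_def)

lemma evid_Sum:
  assumes "mcs \<Gamma>"
  shows "evid N \<Gamma> s \<union> evid N \<Gamma> t \<subseteq> evid N \<Gamma> (Sum s t)"
proof (cases "old_pol N (Sum s t)")
  case True
  then show ?thesis
    using assms mcs_axiom[OF assms(1) A6[of s _ t]] by (auto simp: evid_old)
qed (auto simp: evid_def)

lemma evid_Bang:
  assumes "mcs \<Gamma>" "A \<in> evid N \<Gamma> t"
  shows "Just t A \<in> evid N \<Gamma> (Bang t)"
proof (cases "old_pol N (Bang t)")
  case True
  then show ?thesis using assms mcs_Just[OF assms(1)] by (simp add: evid_old)
qed (auto simp: evid_def)

lemma evid_PConst:
  assumes "mcs \<Gamma>" "axiom A"
  shows "A \<in> evid N \<Gamma> (PConst c)"
proof -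
  have "\<turnstile> Just (PConst c) A"
    by (rule derivable_rule[of "{}"]) (auto intro: R3 assms(2))
  then show ?thesis using mcs_derivable[OF assms(1)] by (simp add: evid_old)
qed

lemma evid_mono:
  assumes "mcs \<Gamma>" "\<And>A. Know A \<in> \<Gamma> \<Longrightarrow> A \<in> \<Delta>"
  shows "evid N \<Gamma> t \<subseteq> evid N \<Delta> t"
proof (cases "old_pol N t")
  case True
  then show ?thesis using assms mcs_Just(3)[OF assms(1)] by (auto simp: evid_old)
next
  case False
  have "Proven A \<in> \<Delta>" if "Proven A \<in> \<Gamma>" for A
    using assms(2) mcs_Proven(2)[OF assms(1) that] by blast
  with False show ?thesis by (auto simp: evid_def split: pol.split)
qed

text \<open>The proofs settled at a node; on the next node of a history, these are the proofs
  presented on that history.\<close>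

fun settled :: "nat \<Rightarrow> 'ag::finite node \<Rightarrow> pol set" where
  "settled N [] = {}"
| "settled N ((\<Gamma>, b) # gs) = insert (yvar N b)
     ({xvar N A i b | A i. Proven A \<in> \<Gamma>} \<union>
      {xvar N A i b | A i j \<Delta>. (\<Delta>, i) \<in> set gs \<and> Prove j A \<in> \<Delta>})"

lemma settled_snoc:
  assumes "m \<noteq> []"
  shows "settled N (m @ [(\<Gamma>, i)]) =
    settled N m \<union> {xvar N A i (snd (hd m)) | A j. Prove j A \<in> \<Gamma>}"
proof -
  obtain \<Delta> b gs where m: "m = (\<Delta>, b) # gs" using assms by (cases m) auto
  show ?thesis unfolding m by simp blast
qed

lemma settled_prefix:
  assumes "prefix m m'"
  shows "settled N m \<subseteq> settled N m'"
proof (cases m)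
  case (Cons g gs)
  obtain gs' where m': "m' = m @ gs'" using assms by (rule prefixE)
  show ?thesis unfolding m' Cons by (cases g) (simp, blast)
qed simp

lemma yvar_settled: "m \<noteq> [] \<Longrightarrow> yvar N (snd (hd m)) \<in> settled N m"
  by (cases "(N, m)" rule: settled.cases) auto

lemma settled_cases:
  fixes m :: "'ag::finite node"
  assumes "t \<in> settled N m"
  obtains "t = yvar N (snd (hd m))" | A :: "'ag form" and i where "t = xvar N A i (snd (hd m))"
  using assms by (cases "(N, m)" rule: settled.cases) auto

text \<open>The choice \<open>g\<close> mediates: knowledge passes from \<open>rep m\<close> to
  \<open>g\<close> by box-equivalence, and what \<open>g\<close> knows holds in its update.\<close>

lemma rep_step:
  assumes "m \<noteq> []" "m \<in> nodes" "g \<in> ext m" "Know A \<in> rep m"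
  shows "A \<in> rep (m @ [g])"
proof -
  have g: "mcs (fst g)" "sim Box (rep m) (fst g)" using assms by (auto simp: ext_def)
  have "Know A \<in> fst g" by (rule sim_Box_Know[OF rep_mcs[OF assms(2,1)] g assms(4)])
  with updates_update[OF g(1)] assms(1) show ?thesis by (simp add: rep_def updates_def)
qed

lemma rep_prefix:
  assumes "prefix m m'" "m \<noteq> []" "m' \<in> nodes" "Know A \<in> rep m"
  shows "Know A \<in> rep m'"
proof -
  obtain gs where "m' = m @ gs" using assms(1) by (rule prefixE)
  moreover have "m @ gs \<in> nodes \<Longrightarrow> Know A \<in> rep (m @ gs)"
  proof (induction gs rule: rev_induct)
    case (snoc g gs)
    then have n: "m @ gs \<in> nodes" "g \<in> ext (m @ gs)" by (simp_all flip: append_assoc)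
    then have "Know (Know A) \<in> rep (m @ gs)"
      using snoc.IH rep_mcs[OF n(1)] assms(2) by (auto intro: mcs_Know_Know)
    with rep_step[OF _ n] assms(2) show ?case by simp
  qed (use assms(4) in simp)
  ultimately show ?thesis using assms(3) by simp
qed

text \<open>A variable \<open>xvar\<close> enters with the initial set, where its formula is proven,
  or with a choice in which its formula is being proved, and then the update has it proven.
  Afterwards A11 preserves it from node to node.\<close>

lemma settled_Proven:
  assumes "m \<in> nodes" "xvar N A i b \<in> settled N m"
  shows "Proven A \<in> rep m"
  using assms
proof (induction m rule: nodes.induct)
  case (snoc m g)
  obtain \<Gamma> k where g: "g = (\<Gamma>, k)" by fastforce
  show ?case
  proof (cases "m = []")
    case True
    with g snoc.prems show ?thesis by (auto simp: rep_def)
  next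
    case False
    from snoc.prems consider "xvar N A i b \<in> settled N m" | j where "Prove j A \<in> \<Gamma>"
      unfolding g settled_snoc[OF False] by auto
    then show ?thesis
    proof cases
      case 1
      then have "Know (Proven A) \<in> rep m"
        using snoc.IH rep_mcs[OF snoc.hyps(1) False] mcs_Proven(2) by blast
      then show ?thesis by (rule rep_step[OF False snoc.hyps])
    next
      case 2
      have "mcs \<Gamma>" using snoc.hyps(2) g by (auto simp: ext_def)
      from updates_update[OF this] 2 g False show ?thesis by (auto simp: rep_def updates_def)
    qed
  qed
qed simp

section \<open>Choice cells, accessibility and evidence of the model\<close>

definition ccell :: "'ag::finite node \<Rightarrow> 'ag \<Rightarrow> 'ag moments set \<Rightarrow> 'ag moments set set" where
  "ccell m j h = {h' \<in> H cframe (enc m).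
     m \<noteq> [] \<longrightarrow> sim (Stit j) (fst (next_choice m h)) (fst (next_choice m h'))}"

text \<open>Cells, presented proofs and valuation all read only the choice made right after the
  moment, so undivided histories agree on them. Epistemic transparency is built into
  \<open>Rel\<close> as inclusion of settled proofs. The root sees every node; its evidence is
  therefore the intersection over all maximal consistent sets, from which evidence can only
  grow.\<close>

definition cmodel :: "nat \<Rightarrow> ('ag::finite, 'ag moments) jstit" where
  "cmodel N = cframe\<lparr>
     Choice := \<lambda>w j. ccell (dec w) j ` H cframe w,
     Act := \<lambda>w h. settled N (dec w @ [next_choice (dec w) h]),
     Rel := {(enc m, enc m') | m m'. m \<in> nodes \<and> m' \<in> nodes \<and>
       (m \<noteq> [] \<longrightarrow> m' \<noteq> [] \<and> (\<forall>A. Know A \<in> rep m \<longrightarrow> A \<in> rep m') \<and> settled N m \<subseteq> settled N m')},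
     Evid := \<lambda>w t. if dec w = [] then {A. \<forall>\<Gamma>. mcs \<Gamma> \<longrightarrow> A \<in> evid N \<Gamma> t} else evid N (rep (dec w)) t,
     Val := \<lambda>p. {(w, h) \<in> MH cframe. Atom p \<in> fst (next_choice (dec w) h)}\<rparr>"

lemma Tree_cmodel: "Tree (cmodel N) = enc ` nodes"
  by (simp add: cmodel_def Tree_cframe)

lemma Ord_cmodel: "Ord (cmodel N) = Ord cframe"
  by (simp add: cmodel_def)

lemma le_cmodel: "le (cmodel N) = le cframe"
  by (simp add: le_def Ord_cmodel fun_eq_iff)

lemma lt_cmodel: "lt (cmodel N) = lt cframe"
  by (simp add: lt_def Ord_cmodel fun_eq_iff)

lemma H_cmodel: "H (cmodel N) = H cframe"
  by (simp add: H_def Hist_def lt_cmodel Tree_cmodel Tree_cframe fun_eq_iff)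

lemma Choice_cmodel: "Choice (cmodel N) (enc m) j = ccell m j ` H cframe (enc m)"
  by (simp add: cmodel_def)

lemma Act_cmodel: "Act (cmodel N) (enc m) h = settled N (m @ [next_choice m h])"
  by (simp add: cmodel_def)

lemma Rel_cmodel:
  "(enc m, enc m') \<in> Rel (cmodel N) \<longleftrightarrow> m \<in> nodes \<and> m' \<in> nodes \<and>
    (m \<noteq> [] \<longrightarrow> m' \<noteq> [] \<and> (\<forall>A. Know A \<in> rep m \<longrightarrow> A \<in> rep m') \<and> settled N m \<subseteq> settled N m')"
  by (auto simp: cmodel_def)

lemma Rel_cmodel_subset: "Rel (cmodel N) \<subseteq> enc ` nodes \<times> enc ` nodes"
  by (auto simp: cmodel_def)

lemma Evid_cmodel:
  "Evid (cmodel N) (enc m) t =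
    (if m = [] then {A. \<forall>\<Gamma>. mcs \<Gamma> \<longrightarrow> A \<in> evid N \<Gamma> t} else evid N (rep m) t)"
  by (simp add: cmodel_def)

lemma lt_cframe: "lt cframe (enc m) (enc m') \<longleftrightarrow> m \<in> nodes \<and> m' \<in> nodes \<and> strict_prefix m m'"
  by (auto simp: cframe.lt_iff le_cframe strict_prefix_def)

lemma Val_cmodel:
  "Val (cmodel N) p = {(w, h) \<in> MH cframe. Atom p \<in> fst (next_choice (dec w) h)}"
  by (simp add: cmodel_def)

lemma MH_cmodel: "MH (cmodel N) = MH cframe"
  by (simp add: MH_def H_cmodel Tree_cmodel Tree_cframe)

lemma ccell_eq_iff:
  assumes "h \<in> H cframe (enc m)" "h' \<in> H cframe (enc m)"
  shows "ccell m j h = ccell m j h' \<longleftrightarrow> h' \<in> ccell m j h"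
  using assms by (fastforce simp: ccell_def sim_def)

lemma ccell_self: "h \<in> H cframe (enc m) \<Longrightarrow> h \<in> ccell m j h"
  by (simp add: ccell_def sim_def)

lemma ccell_subset: "ccell m j h \<subseteq> H cframe (enc m)"
  by (auto simp: ccell_def)

lemma partition_ccell: "partition_on (H cframe (enc m)) (ccell m j ` H cframe (enc m))"
proof (rule partition_onI)
  show "\<Union> (ccell m j ` H cframe (enc m)) = H cframe (enc m)"
    using ccell_self ccell_subset by fast
  show "{} \<notin> ccell m j ` H cframe (enc m)"
    using ccell_self by blast
  show "disjnt p q"
    if pq: "p \<in> ccell m j ` H cframe (enc m)" "q \<in> ccell m j ` H cframe (enc m)" "p \<noteq> q" for p q
    unfolding disjnt_def
  proof (rule equals0I)
    fix g assume g: "g \<in> p \<inter> q"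
    from pq obtain h h' where h: "h \<in> H cframe (enc m)" "p = ccell m j h"
      and h': "h' \<in> H cframe (enc m)" "q = ccell m j h'" by blast
    have "g \<in> H cframe (enc m)" using g h ccell_subset by blast
    with g h h' have "p = ccell m j g" "q = ccell m j g" using ccell_eq_iff by blast+
    with pq show False by blast
  qed
qed

section \<open>Verification of the frame conditions\<close>

context canonical
begin

lemma next_choice_mcs:
  fixes m :: "'ag node"
  assumes "m \<in> nodes" "m \<noteq> []" "h \<in> H cframe (enc m)"
  shows "mcs (fst (next_choice m h))" "sim Box (rep m) (fst (next_choice m h))"
  using next_choice_ext[OF assms(1,3)] assms(2) by (auto simp: ext_def)

lemma ex_next_choice_mcs:
  fixes m :: "'ag node"
  assumes "m \<in> nodes" "m \<noteq> []" "mcs \<Gamma>" "sim Box (rep m) \<Gamma>"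
  shows "\<exists>h \<in> H cframe (enc m). fst (next_choice m h) = \<Gamma>"
proof -
  have "(\<Gamma>, True) \<in> ext m" using assms by (simp add: ext_def)
  from ex_next_choice[OF assms(1) this] obtain h
    where "h \<in> H cframe (enc m)" "next_choice m h = (\<Gamma>, True)" by blast
  then show ?thesis by (intro bexI[of _ h]) simp_all
qed

lemma ex_ccell:
  fixes m :: "'ag node"
  assumes m: "m \<in> nodes" "m \<noteq> []" "h \<in> H cframe (enc m)"
    and \<Delta>: "mcs \<Delta>" "sim (Stit j) (fst (next_choice m h)) \<Delta>"
  shows "\<exists>h' \<in> ccell m j h. fst (next_choice m h') = \<Delta>"
proof -
  note \<Gamma> = next_choice_mcs[OF m]
  have "sim Box (rep m) \<Delta>"
    using \<Gamma>(2) sim_Stit_Box[OF \<Gamma>(1) \<Delta>] by (simp add: sim_def)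
  then obtain h' where "h' \<in> H cframe (enc m)" "fst (next_choice m h') = \<Delta>"
    using ex_next_choice_mcs[OF m(1,2) \<Delta>(1)] by blast
  with \<Delta>(2) show ?thesis by (intro bexI[of _ h']) (auto simp: ccell_def)
qed

lemma ccell_independence:
  fixes m :: "'ag node"
  assumes m: "m \<in> nodes" and h: "\<And>j. h j \<in> H cframe (enc m)"
  shows "(\<Inter>j. ccell m j (h j)) \<noteq> {}"
proof (cases "m = []")
  case True
  \<comment> \<open>At the root every agent has a single cell, the set of all histories.\<close>
  with h have "h undefined \<in> ccell m j (h j)" for j by (simp add: ccell_def)
  then show ?thesis by blast
next
  case False
  let ?\<Gamma> = "\<lambda>j. fst (next_choice m (h j))"
  obtain \<Theta> where \<Theta>: "mcs \<Theta>" "sim Box (rep m) \<Theta>" "\<forall>j. sim (Stit j) (?\<Gamma> j) \<Theta>"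
    using mcs_independence[OF rep_mcs[OF m False], of ?\<Gamma>] next_choice_mcs[OF m False h] by blast
  then obtain g where "g \<in> H cframe (enc m)" "fst (next_choice m g) = \<Theta>"
    using ex_next_choice_mcs[OF m False] by blast
  with \<Theta>(3) have "g \<in> ccell m j (h j)" for j by (simp add: ccell_def)
  then show ?thesis by blast
qed

text \<open>The two copies of a choice add variables with different bits, so they share only what
  was settled before. At the root the initial bit plays this part and nothing is shared.\<close>

lemma settled_INT:
  fixes m :: "'ag node"
  assumes m: "m \<in> nodes"
  shows "(\<Inter>h \<in> H cframe (enc m). settled N (m @ [next_choice m h])) = settled N m"
proof
  show "settled N m \<subseteq> (\<Inter>h \<in> H cframe (enc m). settled N (m @ [next_choice m h]))"
    by (intro INF_greatest settled_prefix) simp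
  show "(\<Inter>h \<in> H cframe (enc m). settled N (m @ [next_choice m h])) \<subseteq> settled N m"
  proof
    fix s assume s: "s \<in> (\<Inter>h \<in> H cframe (enc m). settled N (m @ [next_choice m h]))"
    have sg: "s \<in> settled N (m @ [g])" if "g \<in> ext m" for g
      using ex_next_choice[OF m that] s by auto
    show "s \<in> settled N m"
    proof (cases "m = []")
      case True
      then have "(\<Gamma>0, True) \<in> ext m" "(\<Gamma>0, False) \<in> ext m" using mcs_\<Gamma>0 by (auto simp: ext_def)
      from sg[OF this(1)] sg[OF this(2)] True show ?thesis by auto
    next
      case False
      then have "(rep m, True) \<in> ext m" "(rep m, False) \<in> ext m"
        using rep_mcs[OF m] by (auto simp: ext_def sim_def)
      from sg[OF this(1)] sg[OF this(2)] False show ?thesis by (auto simp: settled_snoc)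
    qed
  qed
qed

lemma evid_cmodel_mono:
  fixes m m' :: "'ag node"
  assumes "(enc m, enc m') \<in> Rel (cmodel N)"
  shows "Evid (cmodel N) (enc m) t \<subseteq> Evid (cmodel N) (enc m') t"
  using assms evid_mono[OF rep_mcs, of m "rep m'" N t] rep_mcs[of m']
  by (auto simp: Rel_cmodel Evid_cmodel)

lemma Rel_cmodel_preorder: "preorder_on (Tree (cmodel N)) (Rel (cmodel N :: ('ag, _) jstit))"
  unfolding preorder_on_def
proof (intro conjI)
  show "Rel (cmodel N :: ('ag, _) jstit) \<subseteq> Tree (cmodel N) \<times> Tree (cmodel N)"
    using Rel_cmodel_subset by (simp add: Tree_cmodel)
  show "refl_on (Tree (cmodel N)) (Rel (cmodel N :: ('ag, _) jstit))"
    using rep_mcs mcs_Know_T by (auto simp: refl_on_def Tree_cmodel Rel_cmodel)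
  show "trans (Rel (cmodel N :: ('ag, _) jstit))"
  proof (rule transI)
    fix x y z :: "'ag moments"
    assume xy: "(x, y) \<in> Rel (cmodel N)" and yz: "(y, z) \<in> Rel (cmodel N)"
    then obtain m m' m'' where m: "x = enc m" "y = enc m'" "z = enc m''" "m \<in> nodes"
      using Rel_cmodel_subset by blast
    have "A \<in> rep m''" if "m \<noteq> []" "Know A \<in> rep m" for A
    proof -
      have "Know (Know A) \<in> rep m" using that rep_mcs[OF m(4)] mcs_Know_Know by blast
      with that xy yz m show ?thesis by (auto simp: Rel_cmodel)
    qed
    with xy yz m show "(x, z) \<in> Rel (cmodel N)" by (auto simp: Rel_cmodel)
  qed
qed

lemma cmodel_future: "Ord (cmodel N) \<subseteq> Rel (cmodel N :: ('ag, _) jstit)"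
proof
  fix x assume "x \<in> Ord (cmodel N :: ('ag, _) jstit)"
  then obtain m m' :: "'ag node" where m: "x = (enc m, enc m')" "m \<in> nodes" "m' \<in> nodes" "prefix m m'"
    by (auto simp: Ord_cmodel cframe_def)
  have "A \<in> rep m'" if "m \<noteq> []" "Know A \<in> rep m" for A
  proof -
    have "m' \<noteq> []" using that(1) m(4) by auto
    then show ?thesis
      using rep_prefix[OF m(4) that(1) m(3) that(2)] rep_mcs[OF m(3)] mcs_Know_T by blast
  qed
  with m settled_prefix[OF m(4)] show "x \<in> Rel (cmodel N)" by (auto simp: Rel_cmodel)
qed

lemma ex_node:
  assumes "x \<in> Tree (cmodel N :: ('ag, _) jstit)"
  obtains m :: "'ag node" where "m \<in> nodes" "x = enc m"
  using assms by (auto simp: Tree_cmodel)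

lemma next_choice_undivided:
  fixes m m' :: "'ag node"
  assumes "m \<in> nodes" "m' \<in> nodes" "strict_prefix m m'" "enc m' \<in> h \<inter> h'"
    and "h \<in> H cframe (enc m)" "h' \<in> H cframe (enc m)"
  shows "next_choice m h = next_choice m h'"
proof -
  have "prefix (m @ [next_choice m h]) m'" "prefix (m @ [next_choice m h']) m'"
    using next_choice_later[OF assms(1,2)] assms by blast+
  then show ?thesis by (auto simp: prefix_def)
qed

lemma cmodel_expansion:
  fixes m m' :: "'ag node"
  assumes "m \<in> nodes" "m' \<in> nodes" "strict_prefix m m'" "h \<in> H cframe (enc m')"
  shows "Act (cmodel N) (enc m) h \<subseteq> settled N m'"
proof -
  have "h \<in> H cframe (enc m)"
    using assms by (intro cframe.H_downward[OF assms(4)]) (auto simp: Tree_cframe le_cframe)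
  then have "prefix (m @ [next_choice m h]) m'"
    using assms by (intro next_choice_later) (auto simp: H_def)
  then show ?thesis by (simp add: Act_cmodel settled_prefix)
qed

text \<open>On a history through \<open>m\<close>, the parent of \<open>m\<close> presents exactly
  what is settled at \<open>m\<close>. The root has no parent but settles nothing.\<close>

lemma cmodel_no_new:
  fixes m :: "'ag node"
  assumes "m \<in> nodes"
  shows "settled N m \<subseteq>
    (\<Union>x \<in> {x \<in> Tree (cmodel N). lt (cmodel N) x (enc m)}. \<Union>h \<in> H cframe (enc m). Act (cmodel N) x h)"
  using assms
proof cases
  case (snoc m' g)
  obtain h where h: "h \<in> H cframe (enc m)"
    using cframe.H_nonempty[of "enc m"] assms by (auto simp: Tree_cframe)
  then have "h \<in> H cframe (enc m')"
    using snoc assms by (intro cframe.H_downward[OF h]) (auto simp: Tree_cframe le_cframe)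
  then have "next_choice m' h = g"
    using snoc h by (intro next_choice_eq) (auto simp: H_def)
  then have "settled N m = Act (cmodel N) (enc m') h" using snoc by (simp add: Act_cmodel)
  moreover have "enc m' \<in> Tree (cmodel N)" "lt (cmodel N) (enc m') (enc m)"
    using snoc assms by (auto simp: Tree_cmodel lt_cmodel lt_cframe strict_prefix_def)
  ultimately show ?thesis using h by blast
qed simp

lemma jstit_model_cmodel: "jstit_model (cmodel N :: ('ag, 'ag moments) jstit)"
proof
  let ?M = "cmodel N :: ('ag, 'ag moments) jstit"
  show "Tree ?M \<noteq> {}" using nodes.Nil by (auto simp: Tree_cmodel)
  show "partial_order_on (Tree ?M) (Ord ?M)"
    using cframe.po by (simp add: Tree_cmodel Ord_cmodel Tree_cframe)
  show "preorder_on (Tree ?M) (Rel ?M)" by (rule Rel_cmodel_preorder)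
  show "Val ?M p \<subseteq> MH ?M" for p
    by (auto simp: Val_cmodel MH_cmodel)
  show "Ord ?M \<subseteq> Rel ?M" by (rule cmodel_future)
next
  fix x y j
  let ?M = "cmodel N :: ('ag, 'ag moments) jstit"
  assume "x \<in> Tree ?M"
  then obtain m where m: "m \<in> nodes" "x = enc m" by (rule ex_node)
  show "partition_on (H ?M x) (Choice ?M x j)"
    using partition_ccell m by (simp add: H_cmodel Choice_cmodel)
  show "(\<Inter>h \<in> H ?M x. Act ?M x h) \<subseteq>
      (\<Union>m' \<in> {m' \<in> Tree ?M. lt ?M m' x}. \<Union>h \<in> H ?M x. Act ?M m' h)"
    using cmodel_no_new[OF m(1), of N] settled_INT[OF m(1), of N] m by (simp add: H_cmodel Act_cmodel)
  show "Evid ?M x s \<union> Evid ?M x t \<subseteq> Evid ?M x (Sum s t)" for s t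
  proof (cases "m = []")
    case True
    with m show ?thesis using evid_Sum[of _ N s t] by (simp add: Evid_cmodel) blast
  next
    case False
    with m show ?thesis using evid_Sum[OF rep_mcs] by (simp add: Evid_cmodel)
  qed
  show "(\<Inter>j. f j) \<noteq> {}" if "\<And>j. f j \<in> Choice ?M x j" for f
  proof -
    have "\<exists>h. \<forall>j. h j \<in> H cframe x \<and> f j = ccell m j (h j)"
      using that m by (intro choice) (auto simp: Choice_cmodel)
    then show ?thesis using ccell_independence[OF m(1)] m by auto
  qed
  show "\<exists>z \<in> Tree ?M. le ?M z x \<and> le ?M z y" if "y \<in> Tree ?M"
  proof (rule bexI)
    from that obtain m' where "m' \<in> nodes" "y = enc m'" by (rule ex_node)
    with m show "le ?M (enc []) x \<and> le ?M (enc []) y"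
      by (simp add: le_cmodel le_cframe nodes.Nil)
    show "enc [] \<in> Tree ?M" unfolding Tree_cmodel by (rule imageI[OF nodes.Nil])
  qed
  show "B \<in> Evid ?M x (App s t)" if "(A \<^bold>\<rightarrow> B) \<in> Evid ?M x s" "A \<in> Evid ?M x t" for A B s t
    using that m evid_App[of _ A B N s t] rep_mcs by (auto simp: Evid_cmodel split: if_splits)
  show "Just t A \<in> Evid ?M x (Bang t)" if "A \<in> Evid ?M x t" for A t
    using that m evid_Bang[of _ A N t] rep_mcs by (auto simp: Evid_cmodel split: if_splits)
next
  fix x y z
  let ?M = "cmodel N :: ('ag, 'ag moments) jstit"
  assume "x \<in> Tree ?M" "y \<in> Tree ?M" "z \<in> Tree ?M" "le ?M y x" "le ?M z x"
  then show "le ?M y z \<or> le ?M z y"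
    using cframe.nbb[of x y z] by (simp add: Tree_cmodel Tree_cframe le_cmodel)
next
  fix x y j h h'
  let ?M = "cmodel N :: ('ag, 'ag moments) jstit"
  assume "x \<in> Tree ?M" "y \<in> Tree ?M" "h \<in> H ?M x" "h' \<in> H ?M x" "lt ?M x y" "y \<in> h \<inter> h'"
  moreover from this obtain m m' where m: "m \<in> nodes" "x = enc m" "m' \<in> nodes" "y = enc m'"
    by (auto elim!: ex_node)
  ultimately have h: "h \<in> H cframe (enc m)" "h' \<in> H cframe (enc m)"
    and eq: "next_choice m h = next_choice m h'"
    using next_choice_undivided by (auto simp: H_cmodel lt_cmodel lt_cframe)
  from h eq have "C \<in> Choice ?M x j \<and> h \<in> C \<longleftrightarrow> C \<in> Choice ?M x j \<and> h' \<in> C" for C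
    using m by (auto simp: Choice_cmodel ccell_def)
  then show "cell ?M x j h = cell ?M x j h'" by (simp add: cell_def)
  show "Act ?M x h = Act ?M x h'" using m eq by (simp add: Act_cmodel)
next
  fix x y t
  let ?M = "cmodel N :: ('ag, 'ag moments) jstit"
  assume "x \<in> Tree ?M" "y \<in> Tree ?M" and R: "(x, y) \<in> Rel ?M"
  then obtain m m' where m: "m \<in> nodes" "x = enc m" "m' \<in> nodes" "y = enc m'"
    by (auto elim!: ex_node)
  with R show "Evid ?M x t \<subseteq> Evid ?M y t" using evid_cmodel_mono by blast
  have "settled N m \<subseteq> settled N m'" using R m by (cases "m = []") (auto simp: Rel_cmodel)
  then show "(\<Inter>h \<in> H ?M x. Act ?M x h) \<subseteq> (\<Inter>h \<in> H ?M y. Act ?M y h)"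
    using m settled_INT[OF m(1), of N] settled_INT[OF m(3), of N] by (simp add: H_cmodel Act_cmodel)
next
  fix x y h
  let ?M = "cmodel N :: ('ag, 'ag moments) jstit"
  assume "x \<in> Tree ?M" "y \<in> Tree ?M" "lt ?M y x" "h \<in> H ?M x"
  moreover from this obtain m m' where m: "m \<in> nodes" "x = enc m" "m' \<in> nodes" "y = enc m'"
    by (auto elim!: ex_node)
  ultimately have "Act ?M y h \<subseteq> settled N m"
    using cmodel_expansion[of m' m h N] by (auto simp: H_cmodel lt_cmodel lt_cframe)
  also have "settled N m \<subseteq> Act ?M x h"
    using settled_prefix[of m "m @ [next_choice m h]" N] m by (simp add: Act_cmodel)
  finally show "Act ?M y h \<subseteq> Act ?M x h" .
qed

lemma normal_cmodel: "normal (cmodel N :: ('ag, 'ag moments) jstit)"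
  by (auto simp: normal_def Tree_cmodel Evid_cmodel evid_PConst rep_mcs)

lemma cell_cmodel:
  fixes m :: "'ag node"
  assumes "m \<in> nodes" "h \<in> H cframe (enc m)"
  shows "cell (cmodel N) (enc m) j h = ccell m j h"
  using assms by (intro jstit_model.cell_unique[OF jstit_model_cmodel])
    (auto simp: Tree_cmodel Choice_cmodel intro: ccell_self)

section \<open>The truth lemma\<close>

lemma sat_Know_cmodel:
  fixes m :: "'ag node"
  assumes truth: "\<And>m h. m \<in> nodes \<Longrightarrow> m \<noteq> [] \<Longrightarrow> h \<in> H cframe (enc m) \<Longrightarrow>
      sat (cmodel N) (enc m) h A \<longleftrightarrow> A \<in> fst (next_choice m h)"
    and m: "m \<in> nodes" "m \<noteq> []" and h: "h \<in> H cframe (enc m)"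
  shows "sat (cmodel N) (enc m) h (Know A) \<longleftrightarrow> Know A \<in> fst (next_choice m h)"
proof
  note \<Gamma> = next_choice_mcs[OF m h]
  have sim': "sim Box (fst (next_choice m h)) (rep m)" using \<Gamma>(2) sim_sym by blast
  show "sat (cmodel N) (enc m) h (Know A)" if K: "Know A \<in> fst (next_choice m h)"
    unfolding sat.simps
  proof (intro ballI impI)
    fix x h' assume x: "x \<in> Tree (cmodel N)" and R: "(enc m, x) \<in> Rel (cmodel N)"
      and h': "h' \<in> H (cmodel N) x"
    from x obtain m' where m': "m' \<in> nodes" "x = enc m'" by (rule ex_node)
    with R m have "m' \<noteq> []" by (simp add: Rel_cmodel)
    \<comment> \<open>Accessibility speaks about \<open>rep m'\<close>, whereas truth on
      \<open>h'\<close> is read from a set merely box-equivalent to it; the inner \<open>Box\<close>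
      bridges this gap.\<close>
    have "Know (Box A) \<in> rep m"
      using mcs_Know_box[OF rep_mcs[OF m] sim_Box_Know[OF \<Gamma>(1) rep_mcs[OF m] sim' K]] .
    with R m m' have "Box A \<in> rep m'" by (simp add: Rel_cmodel)
    moreover note \<Gamma>' = next_choice_mcs[OF m'(1) \<open>m' \<noteq> []\<close>, of h']
    ultimately have "A \<in> fst (next_choice m' h')"
      using h' m' sim_sub[OF S5_op_Box] by (simp add: H_cmodel)
    then show "sat (cmodel N) x h' A" using truth m' \<open>m' \<noteq> []\<close> h' by (simp add: H_cmodel)
  qed
  show "Know A \<in> fst (next_choice m h)" if S: "sat (cmodel N) (enc m) h (Know A)"
  proof (rule ccontr)
    assume "Know A \<notin> fst (next_choice m h)"
    then have "Know A \<notin> rep m" using sim_Box_Know[OF rep_mcs[OF m] \<Gamma>] by blast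
    from mcs_existence[OF normal_op_Know rep_mcs[OF m] this] obtain \<Delta>
      where \<Delta>: "mcs \<Delta>" "\<forall>B. Know B \<in> rep m \<longrightarrow> B \<in> \<Delta>" "A \<notin> \<Delta>" by blast
    \<comment> \<open>Keeping the initial bit of \<open>m\<close> keeps its \<open>yvar\<close>. An
      \<open>xvar\<close> settled at \<open>m\<close> has a formula that is proven, hence known to
      be proven, hence proven in \<Delta>; as an initial set, \<Delta> settles both copies of that
      variable.\<close>
    let ?m = "[(\<Delta>, snd (hd m))]"
    have ext: "(\<Delta>, snd (hd m)) \<in> ext []" using \<Delta>(1) by (simp add: ext_def)
    have m': "?m \<in> nodes" using nodes.snoc[OF nodes.Nil ext] by simp
    have rep: "rep ?m = \<Delta>" by (simp add: rep_def)
    have "sim Box (rep ?m) \<Delta>" by (simp add: rep sim_def)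
    then obtain h' where h': "h' \<in> H cframe (enc ?m)" "fst (next_choice ?m h') = \<Delta>"
      using ex_next_choice_mcs[OF m' _ \<Delta>(1)] by blast
    have "settled N m \<subseteq> settled N ?m"
    proof
      fix t assume t: "t \<in> settled N m"
      have P: "xvar N B i b \<in> settled N m \<Longrightarrow> Proven B \<in> \<Delta>" for B i b
        using settled_Proven[OF m(1)] mcs_Proven(2)[OF rep_mcs[OF m]] \<Delta>(2) by blast
      from t show "t \<in> settled N ?m" by (cases rule: settled_cases) (use t P in auto)
    qed
    then have "(enc m, enc ?m) \<in> Rel (cmodel N)"
      using m m' \<Delta>(2) rep by (auto simp: Rel_cmodel)
    then have "sat (cmodel N) (enc ?m) h' A"
      using S m' h'(1) by (auto simp: Tree_cmodel H_cmodel)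
    then have "A \<in> \<Delta>" using truth[OF m' _ h'(1)] h'(2) by simp
    with \<Delta>(3) show False ..
  qed
qed

text \<open>The variable \<open>yvar\<close> serves proven formulas, even those that were never
  being proved along the node, and \<open>xvar\<close> serves those being proved on
  \<open>h\<close>. No other evidence is presented, because a settled \<open>xvar\<close> supports
  only a formula already proven.\<close>

lemma ex_proof_iff:
  fixes m :: "'ag node"
  assumes m: "m \<in> nodes" "m \<noteq> []" and h: "h \<in> H cframe (enc m)"
  shows "(\<exists>t \<in> Act (cmodel N) (enc m) h. A \<in> Evid (cmodel N) (enc m) t) \<longleftrightarrow>
    Proven A \<in> fst (next_choice m h) \<or> (\<exists>j. Prove j A \<in> fst (next_choice m h))"
proof -
  obtain \<Gamma> i where \<Gamma>i: "next_choice m h = (\<Gamma>, i)" by fastforce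
  have \<Gamma>: "mcs \<Gamma>" "sim Box (rep m) \<Gamma>" using next_choice_mcs[OF m h] \<Gamma>i by simp_all
  have Act: "Act (cmodel N) (enc m) h =
      settled N m \<union> {xvar N A i (snd (hd m)) | A j. Prove j A \<in> \<Gamma>}"
    using m(2) by (simp add: Act_cmodel \<Gamma>i settled_snoc)
  have Evid: "Evid (cmodel N) (enc m) t = evid N (rep m) t" for t
    using m(2) by (simp add: Evid_cmodel)
  have Proven: "Proven A \<in> rep m \<longleftrightarrow> Proven A \<in> \<Gamma>"
    by (rule Know_sim_iff[OF rep_mcs[OF m] \<Gamma> mcs_Proven(2)])
  show ?thesis
  proof
    assume "\<exists>t \<in> Act (cmodel N) (enc m) h. A \<in> Evid (cmodel N) (enc m) t"
    then obtain t where t: "t \<in> Act (cmodel N) (enc m) h" "A \<in> evid N (rep m) t"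
      by (auto simp: Evid)
    from t(1) consider "t \<in> settled N m" | B j where "t = xvar N B i (snd (hd m))" "Prove j B \<in> \<Gamma>"
      by (auto simp: Act)
    then show "Proven A \<in> fst (next_choice m h) \<or> (\<exists>j. Prove j A \<in> fst (next_choice m h))"
    proof cases
      case 1
      have "Proven A \<in> rep m"
        using 1 t(2) settled_Proven[OF m(1)] by (cases rule: settled_cases[OF 1]) auto
      with Proven \<Gamma>i show ?thesis by simp
    next
      case 2
      with t(2) \<Gamma>i show ?thesis by auto
    qed
  next
    assume "Proven A \<in> fst (next_choice m h) \<or> (\<exists>j. Prove j A \<in> fst (next_choice m h))"
    then show "\<exists>t \<in> Act (cmodel N) (enc m) h. A \<in> Evid (cmodel N) (enc m) t"
    proof
      assume "Proven A \<in> fst (next_choice m h)"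
      then have "A \<in> Evid (cmodel N) (enc m) (yvar N (snd (hd m)))"
        using Proven \<Gamma>i by (simp add: Evid)
      moreover have "yvar N (snd (hd m)) \<in> Act (cmodel N) (enc m) h"
        using yvar_settled[OF m(2)] by (simp add: Act)
      ultimately show ?thesis by blast
    next
      assume "\<exists>j. Prove j A \<in> fst (next_choice m h)"
      then have "xvar N A i (snd (hd m)) \<in> Act (cmodel N) (enc m) h"
        using \<Gamma>i by (auto simp: Act)
      moreover have "A \<in> Evid (cmodel N) (enc m) (xvar N A i (snd (hd m)))" by (simp add: Evid)
      ultimately show ?thesis by blast
    qed
  qed
qed

text \<open>Being presented on all histories means being settled, by \<open>settled_INT\<close>.
  This decides both the clause for \<open>Proven\<close> and the negative clause for
  \<open>Prove\<close>.\<close>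

lemma ex_settled_proof_iff:
  fixes m :: "'ag node"
  assumes m: "m \<in> nodes" "m \<noteq> []"
  shows "(\<exists>t. (\<forall>h \<in> H cframe (enc m). t \<in> Act (cmodel N) (enc m) h) \<and> A \<in> Evid (cmodel N) (enc m) t)
    \<longleftrightarrow> Proven A \<in> rep m"
proof -
  have Evid: "Evid (cmodel N) (enc m) t = evid N (rep m) t" for t
    using m(2) by (simp add: Evid_cmodel)
  have Act: "(\<forall>h \<in> H cframe (enc m). t \<in> Act (cmodel N) (enc m) h) \<longleftrightarrow> t \<in> settled N m" for t
    using settled_INT[OF m(1), of N] by (auto simp: Act_cmodel)
  have "Proven A \<in> rep m" if "t \<in> settled N m" "A \<in> evid N (rep m) t" for t
    using that settled_Proven[OF m(1)] by (cases rule: settled_cases[OF that(1)]) auto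
  moreover have "A \<in> evid N (rep m) (yvar N (snd (hd m)))" if "Proven A \<in> rep m"
    using that by simp
  ultimately show ?thesis using yvar_settled[OF m(2)] unfolding Evid Act by blast
qed

lemma truth:
  fixes m :: "'ag node"
  assumes "old N A" "m \<in> nodes" "m \<noteq> []" "h \<in> H cframe (enc m)"
  shows "sat (cmodel N) (enc m) h A \<longleftrightarrow> A \<in> fst (next_choice m h)"
  using assms
proof (induction A arbitrary: m h)
  case (Atom p)
  then show ?case
    by (auto simp: Val_cmodel MH_def Tree_cframe)
next
  case (And A B)
  then show ?case using next_choice_mcs[OF And.prems(2-4)] by simp
next
  case (Neg A)
  then show ?case using next_choice_mcs[OF Neg.prems(2-4)] by simp
next
  case (Stit j A)
  note m = Stit.prems(2-4)
  let ?\<Gamma> = "fst (next_choice m h)"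
  note \<Gamma> = next_choice_mcs[OF m]
  have "sat (cmodel N) (enc m) h' A \<longleftrightarrow> A \<in> fst (next_choice m h')" if "h' \<in> ccell m j h" for h'
    using Stit that ccell_subset[of m j h] by auto
  then have "sat (cmodel N) (enc m) h (Stit j A) \<longleftrightarrow> (\<forall>h' \<in> ccell m j h. A \<in> fst (next_choice m h'))"
    by (simp add: cell_cmodel[OF m(1,3)])
  also have "\<dots> \<longleftrightarrow> Stit j A \<in> ?\<Gamma>"
  proof
    assume "Stit j A \<in> ?\<Gamma>"
    then show "\<forall>h' \<in> ccell m j h. A \<in> fst (next_choice m h')"
      using m sim_sub[OF S5_op_Stit] next_choice_mcs[OF m(1,2)] by (fastforce simp: ccell_def)
  next
    assume all: "\<forall>h' \<in> ccell m j h. A \<in> fst (next_choice m h')"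
    show "Stit j A \<in> ?\<Gamma>"
    proof (rule ccontr)
      assume "Stit j A \<notin> ?\<Gamma>"
      from sim_existence[OF S5_op_Stit \<Gamma>(1) this] obtain \<Delta>
        where \<Delta>: "mcs \<Delta>" "sim (Stit j) ?\<Gamma> \<Delta>" "A \<notin> \<Delta>" by blast
      from ex_ccell[OF m \<Delta>(1,2)] all \<Delta>(3) show False by blast
    qed
  qed
  finally show ?case .
next
  case (Box A)
  note m = Box.prems(2-4)
  let ?\<Gamma> = "fst (next_choice m h)"
  note \<Gamma> = next_choice_mcs[OF m]
  have "sat (cmodel N) (enc m) h (Box A) \<longleftrightarrow>
      (\<forall>h' \<in> H cframe (enc m). A \<in> fst (next_choice m h'))"
    using Box by (simp add: H_cmodel)
  also have "\<dots> \<longleftrightarrow> Box A \<in> rep m"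
  proof
    assume "Box A \<in> rep m"
    then show "\<forall>h' \<in> H cframe (enc m). A \<in> fst (next_choice m h')"
      using sim_sub[OF S5_op_Box] next_choice_mcs[OF m(1,2)] by blast
  next
    assume all: "\<forall>h' \<in> H cframe (enc m). A \<in> fst (next_choice m h')"
    show "Box A \<in> rep m"
    proof (rule ccontr)
      assume "Box A \<notin> rep m"
      from sim_existence[OF S5_op_Box rep_mcs[OF m(1,2)] this] obtain \<Delta>
        where \<Delta>: "mcs \<Delta>" "sim Box (rep m) \<Delta>" "A \<notin> \<Delta>" by blast
      from ex_next_choice_mcs[OF m(1,2) \<Delta>(1,2)] all \<Delta>(3) show False by blast
    qed
  qed
  also have "\<dots> \<longleftrightarrow> Box A \<in> ?\<Gamma>" using \<Gamma>(2) by (simp add: sim_def)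
  finally show ?case .
next
  case (Know A)
  show ?case
    by (rule sat_Know_cmodel) (use Know in auto)
next
  case (Just t A)
  note m = Just.prems(2-4)
  note \<Gamma> = next_choice_mcs[OF m]
  have K: "sat (cmodel N) (enc m) h (Know A) \<longleftrightarrow> Know A \<in> fst (next_choice m h)"
    by (rule sat_Know_cmodel) (use Just in auto)
  \<comment> \<open>The restriction to old formulas is used here: evidence for an old polynomial is
    membership in the set.\<close>
  have "A \<in> Evid (cmodel N) (enc m) t \<longleftrightarrow> Just t A \<in> rep m"
    using Just.prems(1) m(2) by (simp add: Evid_cmodel evid_old)
  also have "\<dots> \<longleftrightarrow> Just t A \<in> fst (next_choice m h)"
    by (rule Know_sim_iff[OF rep_mcs[OF m(1,2)] \<Gamma> mcs_Just(3)])
  finally show ?case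
    using K mcs_Just(1)[OF \<Gamma>(1)] by (simp only: sat.simps(7)) blast
next
  case (Prove j A)
  note m = Prove.prems(2-4)
  let ?\<Gamma> = "fst (next_choice m h)"
  note \<Gamma> = next_choice_mcs[OF m]
  have K: "sat (cmodel N) (enc m) h' (Know A) \<longleftrightarrow> Know A \<in> fst (next_choice m h')"
    if "h' \<in> H cframe (enc m)" for h'
    by (rule sat_Know_cmodel) (use Prove that in auto)
  have K\<Gamma>: "sat (cmodel N) (enc m) h' (Know A) \<longleftrightarrow> Know A \<in> ?\<Gamma>" for h'
    using K[OF m(3)] by simp
  have Proven: "Proven A \<in> fst (next_choice m h') \<longleftrightarrow> Proven A \<in> rep m"
    if "h' \<in> H cframe (enc m)" for h'
    using Know_sim_iff[OF rep_mcs[OF m(1,2)] next_choice_mcs[OF m(1,2) that] mcs_Proven(2)] by blast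
  \<comment> \<open>Presented evidence means that \<open>A\<close> is proven or somebody is proving
    it, and a common proof means that \<open>A\<close> is proven. \<open>Proven A\<close> and
    \<open>Know A\<close> do not vary with the history.\<close>
  have "sat (cmodel N) (enc m) h (Prove j A) \<longleftrightarrow>
      (\<forall>h' \<in> ccell m j h. (Proven A \<in> rep m \<or> (\<exists>i. Prove i A \<in> fst (next_choice m h'))) \<and> Know A \<in> ?\<Gamma>) \<and>
      \<not> (Proven A \<in> rep m \<and> Know A \<in> ?\<Gamma>)"
  proof -
    have "(\<forall>h' \<in> ccell m j h. \<exists>t \<in> Act (cmodel N) (enc m) h'. sat (cmodel N) (enc m) h' (Just t A)) \<longleftrightarrow>
        (\<forall>h' \<in> ccell m j h. (Proven A \<in> rep m \<or> (\<exists>i. Prove i A \<in> fst (next_choice m h'))) \<and> Know A \<in> ?\<Gamma>)"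
    proof (intro ball_cong refl)
      fix h' assume "h' \<in> ccell m j h"
      then have h': "h' \<in> H cframe (enc m)" using ccell_subset by blast
      show "(\<exists>t \<in> Act (cmodel N) (enc m) h'. sat (cmodel N) (enc m) h' (Just t A)) \<longleftrightarrow>
          (Proven A \<in> rep m \<or> (\<exists>i. Prove i A \<in> fst (next_choice m h'))) \<and> Know A \<in> ?\<Gamma>"
        using ex_proof_iff[OF m(1,2) h', of N A] Proven[OF h'] K\<Gamma>[of h']
        unfolding sat.simps(7) by blast
    qed
    moreover have "(\<forall>s. \<exists>h'' \<in> H cframe (enc m). sat (cmodel N) (enc m) h (Just s A) \<longrightarrow>
        s \<notin> Act (cmodel N) (enc m) h'') \<longleftrightarrow> \<not> (Proven A \<in> rep m \<and> Know A \<in> ?\<Gamma>)"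
      using ex_settled_proof_iff[OF m(1,2), of N A] K\<Gamma>[of h] m(3) unfolding sat.simps(7) by blast
    ultimately show ?thesis by (simp only: sat.simps(8) cell_cmodel[OF m(1,3)] H_cmodel)
  qed
  also have "\<dots> \<longleftrightarrow> Prove j A \<in> ?\<Gamma>"
  proof
    assume P: "Prove j A \<in> ?\<Gamma>"
    then have "Know A \<in> ?\<Gamma>" "Proven A \<notin> ?\<Gamma>" "Stit j (Prove j A) \<in> ?\<Gamma>"
      using mcs_Prove[OF \<Gamma>(1)] by blast+
    moreover have "Prove j A \<in> fst (next_choice m h')" if "h' \<in> ccell m j h" for h'
      using sim_sub[OF S5_op_Stit _ next_choice_mcs(1)[OF m(1,2)]] that m(2) calculation(3)
      by (auto simp: ccell_def)
    ultimately show "(\<forall>h' \<in> ccell m j h. (Proven A \<in> rep m \<or>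
        (\<exists>i. Prove i A \<in> fst (next_choice m h'))) \<and> Know A \<in> ?\<Gamma>) \<and> \<not> (Proven A \<in> rep m \<and> Know A \<in> ?\<Gamma>)"
      using Proven[OF m(3)] by blast
  next
    assume S: "(\<forall>h' \<in> ccell m j h. (Proven A \<in> rep m \<or>
        (\<exists>i. Prove i A \<in> fst (next_choice m h'))) \<and> Know A \<in> ?\<Gamma>) \<and> \<not> (Proven A \<in> rep m \<and> Know A \<in> ?\<Gamma>)"
    then have "Proven A \<notin> rep m" using ccell_self[OF m(3)] by blast
    show "Prove j A \<in> ?\<Gamma>"
    proof (rule ccontr)
      \<comment> \<open>On each history of the cell the agent proving \<open>A\<close> may differ
        from \<open>j\<close>. A13 supplies a history of the cell on which nobody proves it, and
        since \<open>A\<close> is not proven, no evidence for it is presented there.\<close>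
      assume "Prove j A \<notin> ?\<Gamma>"
      from mcs_not_Prove[OF \<Gamma>(1) this] obtain \<Delta>
        where \<Delta>: "mcs \<Delta>" "sim (Stit j) ?\<Gamma> \<Delta>" "\<forall>i. Prove i A \<notin> \<Delta>" by blast
      from ex_ccell[OF m \<Delta>(1,2)] S \<open>Proven A \<notin> rep m\<close> \<Delta>(3) show False by blast
    qed
  qed
  finally show ?case .
next
  case (Proven A)
  note m = Proven.prems(2-4)
  note \<Gamma> = next_choice_mcs[OF m]
  have K: "sat (cmodel N) (enc m) h (Know A) \<longleftrightarrow> Know A \<in> fst (next_choice m h)"
    by (rule sat_Know_cmodel) (use Proven in auto)
  have "sat (cmodel N) (enc m) h (Proven A) \<longleftrightarrow>
      Proven A \<in> rep m \<and> Know A \<in> fst (next_choice m h)"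
    unfolding sat.simps(9) H_cmodel
    using ex_settled_proof_iff[OF m(1,2), of N A] K m(3) unfolding sat.simps(7) by blast
  also have "\<dots> \<longleftrightarrow> Proven A \<in> fst (next_choice m h)"
    using Know_sim_iff[OF rep_mcs[OF m(1,2)] \<Gamma> mcs_Proven(2)] mcs_Proven(1)[OF \<Gamma>(1)] by blast
  finally show ?case .
qed

end

section \<open>Completeness and the equivalence\<close>

theorem completeness:
  fixes A :: "'ag::finite form"
  assumes "valid_normal TYPE('ag moments) A"
  shows "\<turnstile> A"
proof (rule ccontr)
  assume nA: "\<not> \<turnstile> A"
  have "consistent {\<^bold>\<not> A}"
    unfolding consistent_def
  proof
    assume "\<exists>As. set As \<subseteq> {\<^bold>\<not> A} \<and> \<turnstile> Imps As \<^bold>\<bottom>"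
    then obtain As where As: "set As \<subseteq> {\<^bold>\<not> A}" "\<turnstile> Imps As \<^bold>\<bottom>" by blast
    have "\<turnstile> A" by (rule derivable_taut[of "[Imps As \<^bold>\<bottom>]"]) (use As in auto)
    with nA show False ..
  qed
  then obtain \<Gamma> where "mcs \<Gamma>" "\<^bold>\<not> A \<in> \<Gamma>" using lindenbaum by blast
  then have \<Gamma>: "mcs \<Gamma>" "A \<notin> \<Gamma>" by simp_all
  interpret canonical \<Gamma> by unfold_locales (rule \<Gamma>(1))
  obtain N where N: "old N A" using ex_old by blast
  \<comment> \<open>On a one-element node \<open>rep\<close> is the initial set itself, so \<Gamma>
    is also available as the choice after it; either bit would do.\<close>
  let ?m = "[(\<Gamma>, True)]"
  have "(\<Gamma>, True) \<in> ext []" using \<Gamma>(1) by (simp add: ext_def)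
  then have m: "?m \<in> nodes" using nodes.snoc[OF nodes.Nil] by fastforce
  have "sim Box (rep ?m) \<Gamma>" by (simp add: rep_def sim_def)
  then obtain h where h: "h \<in> H cframe (enc ?m)" "fst (next_choice ?m h) = \<Gamma>"
    using ex_next_choice_mcs[OF m _ \<Gamma>(1)] by blast
  then have "\<not> sat (cmodel N) (enc ?m) h A" using truth[OF N m _ h(1)] \<Gamma>(2) by simp
  moreover have "(enc ?m, h) \<in> MH (cmodel N)" using m h by (auto simp: MH_def Tree_cmodel H_cmodel)
  ultimately show False
    using assms jstit_model_cmodel[of N] normal_cmodel[of N] unfolding valid_normal_def by blast
qed

text \<open>Soundness holds over every type of moments, completeness needs the large universe. With
  \<open>'m\<close> schematic, the two conjuncts together express validity over all models.\<close>

theorem corollary2: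
  fixes A :: "'ag::finite form"
  shows "\<turnstile> A \<longleftrightarrow> valid_normal TYPE('m) A \<and> valid_normal TYPE('ag moments) A"
proof
  assume "\<turnstile> A"
  then show "valid_normal TYPE('m) A \<and> valid_normal TYPE('ag moments) A"
    by (intro conjI soundness)
qed (intro completeness, erule conjunct2)

end
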